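(* Fix a directed graph on $n$ nodes with edge set $E$, a set $\mathcal{B}$ of excited nodes and a set $\mathcal{C}$ of measured nodes with selection matrices $B$ and $C$. Let $(i,j)$ be such that the edge $j\to i$ belongs to $E$, and let $e\in\{1,\dots,|E|\}$ be the index of the entry $G_{ij}$ in the parameter vector $x$. For $x\in\mathbb{C}^{|E|}$ with $\det(I-G(x))\neq 0$, let $T(x)=(I-G(x))^{-1}$ and $$K(x)=\big(B^T T^T(x)\otimes C\,T(x)\big)\, I_G .$$ Then exactly one of the two following holds: (i) $\ker K(x)\perp \mathbf{e}_e$ for almost all $x$, and $G_{ij}$ is generically locally identifiable; (ii) $\ker K(x)\perp \mathbf{e}_e$ for almost no $x$, and $G_{ij}$ is generically locally non-identifiable, hence generically non-identifiable. Moreover, for $G=G(x)$, the condition $\ker K(x)\perp \mathbf{e}_e$ is equivalent to the following implication holding for all matrices $\Delta\in\mathbb{C}^{n\times n}$ consistent with the graph: $$C(I-G)^{-1}\Delta (I-G)^{-1}B=0 \;\Rightarrow\; \Delta_{ij}=0 .$$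
   Context: Setting. A directed graph on nodes $1,\dots,n$ with edge set $E$ is fixed. A matrix $A\in\mathbb{C}^{n\times n}$ is consistent with the graph if $A_{ij}=0$ whenever $j\to i$ is not an edge. Network matrices $G$ are complex $n\times n$ matrices consistent with the graph (a single frequency is considered) for which $I-G$ is invertible. The nodes in $\mathcal{B}$ are excited and those in $\mathcal{C}$ are measured. $B\in\{0,1\}^{n\times|\mathcal{B}|}$ is the full column rank matrix whose columns are the standard basis vectors of the nodes in $\mathcal{B}$. $C\in\{0,1\}^{|\mathcal{C}|\times n}$ is the full row rank matrix whose rows are the transposed standard basis vectors of the nodes in $\mathcal{C}$. Parametrization. Enumerate the edges $1,\dots,|E|$. For $x\in\mathbb{C}^{|E|}$, $G(x)$ is the matrix consistent with the graph whose entry at the position of the $k$-th edge is $x_k$ for each $k$ (so $x\mapsto G(x)$ is a linear bijection onto the matrices consistent with the graph). $\mathbf{e}_k$ denotes the $k$-th standard basis vector of $\mathbb{C}^{|E|}$. $\mathrm{vec}$ stacks the columns of a matrix into a vector, $\otimes$ is the Kronecker product, and $I_G=[\mathrm{vec}(G(\mathbf{e}_1))\ \mathrm{vec}(G(\mathbf{e}_2))\cdots \mathrm{vec}(G(\mathbf{e}_{|E|}))]\in\{0,1\}^{n^2\times|E|}$. The notation $\ker K(x)\perp\mathbf{e}_e$ means that $\delta_e=0$ for every $\delta\in\mathbb{C}^{|E|}$ with $K(x)\delta=0$. Identifiability. $G_{ij}$ is identifiable at $G$ if for every network matrix $\tilde G$ consistent with the graph (with $I-\tilde G$ invertible), $C(I-\tilde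 G)^{-1}B=C(I-G)^{-1}B$ implies $\tilde G_{ij}=G_{ij}$. $G_{ij}$ is locally identifiable at $G$ if there exists $\epsilon>0$ such that this implication holds for every such $\tilde G$ satisfying $\|\tilde G-G\|<\epsilon$. Genericity. A property holds for almost all (resp. almost no) $x$ if it holds for all (resp. no) $x\in\mathbb{C}^{|E|}$ with $\det(I-G(x))\ne0$, except possibly those lying on a lower-dimensional set, i.e. a set of dimension lower than that of the ambient space. $G_{ij}$ is generically (locally) identifiable if it is (locally) identifiable at $G(x)$ for almost all $x$, and generically (locally) non-identifiable if it is (locally) identifiable at $G(x)$ for almost no $x$. *)

theory Defs
  imports "HOL-Analysis.Analysis"
begin

text \<open>
  Vectors and matrices are indexed by finite types: \<open>'n\<close> for the nodes, \<open>'e\<close> for the edges,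
  \<open>'b\<close> and \<open>'c\<close> for the excited and the measured nodes. A pair \<open>(j, i)\<close> stands for the edge
  from \<open>j\<close> to \<open>i\<close>, which carries the matrix entry in row \<open>i\<close> and column \<open>j\<close>.
\<close>

definition consistent :: "('n::finite \<times> 'n) set \<Rightarrow> complex^'n^'n \<Rightarrow> bool" where
  "consistent E A \<longleftrightarrow> (\<forall>i j. (j, i) \<notin> E \<longrightarrow> A $ i $ j = 0)"

definition network_matrix :: "('n::finite \<times> 'n) set \<Rightarrow> complex^'n^'n \<Rightarrow> bool" where
  "network_matrix E G \<longleftrightarrow> consistent E G \<and> invertible (mat 1 - G)"

text \<open>
  For a nonempty set \<open>\<B>\<close> enumerated by \<open>exc\<close> the columns are the standard basis vectors of its
  nodes, and the condition \<open>v \<in> \<B>\<close> is redundant; likewise for \<open>\<C>\<close> and \<open>meas\<close>. As index types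
  are nonempty, the matrix without columns (rows) that belongs to the empty set is represented by
  zero columns (rows): either way every product \<open>C ** X ** B\<close> carries no information on \<open>X\<close>.
\<close>

definition excitation_matrix :: "'n set \<Rightarrow> ('b::finite \<Rightarrow> 'n::finite) \<Rightarrow> complex^'b^'n" where
  "excitation_matrix \<B> exc = (\<chi> v k. if v \<in> \<B> \<and> v = exc k then 1 else 0)"

definition measurement_matrix :: "'n set \<Rightarrow> ('c::finite \<Rightarrow> 'n::finite) \<Rightarrow> complex^'n^'c" where
  "measurement_matrix \<C> meas = (\<chi> k v. if v \<in> \<C> \<and> v = meas k then 1 else 0)"


subsection \<open>Parametrization\<close>

text \<open>For an injective enumeration \<open>edge\<close>, at most one summand below is nonzero.\<close>

definition param :: "('e::finite \<Rightarrow> 'n::finite \<times> 'n) \<Rightarrow> complex^'e \<Rightarrow> complex^'n^'n" where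
  "param edge x = (\<chi> i j. \<Sum>k\<in>UNIV. if edge k = (j, i) then x $ k else 0)"

text \<open>
  Stacking columns: the index of an entry is the pair (column, row), read lexicographically.
\<close>

definition vectorize :: "complex^'m::finite^'k::finite \<Rightarrow> complex^('m \<times> 'k)" where
  "vectorize A = (\<chi> p. A $ snd p $ fst p)"

definition kronecker ::
    "complex^'q::finite^'p::finite \<Rightarrow> complex^'s::finite^'r::finite \<Rightarrow> complex^('q \<times> 's)^('p \<times> 'r)" where
  "kronecker X Y = (\<chi> u v. X $ fst u $ fst v * Y $ snd u $ snd v)"

definition edge_selection :: "('e::finite \<Rightarrow> 'n::finite \<times> 'n) \<Rightarrow> complex^'e^('n \<times> 'n)" where
  "edge_selection edge = (\<chi> p k. vectorize (param edge (axis k 1)) $ p)"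

definition transfer_matrix :: "('e::finite \<Rightarrow> 'n::finite \<times> 'n) \<Rightarrow> complex^'e \<Rightarrow> complex^'n^'n" where
  "transfer_matrix edge x = matrix_inv (mat 1 - param edge x)"

definition K_matrix ::
    "('e::finite \<Rightarrow> 'n::finite \<times> 'n) \<Rightarrow> complex^'b^'n \<Rightarrow> complex^'n^'c \<Rightarrow> complex^'e
      \<Rightarrow> complex^'e^('b \<times> 'c)" where
  "K_matrix edge B C x =
     kronecker (transpose B ** transpose (transfer_matrix edge x)) (C ** transfer_matrix edge x)
       ** edge_selection edge"

definition ker_perp :: "complex^'e^'r \<Rightarrow> 'e::finite \<Rightarrow> bool" where
  "ker_perp M e \<longleftrightarrow> (\<forall>\<delta>. M *v \<delta> = 0 \<longrightarrow> \<delta> $ e = 0)"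


subsection \<open>Identifiability\<close>

definition identifiable ::
    "('n::finite \<times> 'n) set \<Rightarrow> complex^'b^'n \<Rightarrow> complex^'n^'c \<Rightarrow> 'n \<Rightarrow> 'n \<Rightarrow> complex^'n^'n \<Rightarrow> bool"
where
  "identifiable E B C i j G \<longleftrightarrow>
     (\<forall>G'. network_matrix E G' \<longrightarrow>
        C ** matrix_inv (mat 1 - G') ** B = C ** matrix_inv (mat 1 - G) ** B \<longrightarrow>
        G' $ i $ j = G $ i $ j)"

definition locally_identifiable ::
    "('n::finite \<times> 'n) set \<Rightarrow> complex^'b^'n \<Rightarrow> complex^'n^'c \<Rightarrow> 'n \<Rightarrow> 'n \<Rightarrow> complex^'n^'n \<Rightarrow> bool"
where
  "locally_identifiable E B C i j G \<longleftrightarrow>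
     (\<exists>\<epsilon>>0. \<forall>G'. network_matrix E G' \<longrightarrow> norm (G' - G) < \<epsilon> \<longrightarrow>
        C ** matrix_inv (mat 1 - G') ** B = C ** matrix_inv (mat 1 - G) ** B \<longrightarrow>
        G' $ i $ j = G $ i $ j)"


subsection \<open>Genericity\<close>

text \<open>
  The dimension of an arbitrary subset of the parameter space is its Hausdorff dimension.
  Boundedness of the covering sets is required because \<^const>\<open>diameter\<close> is unspecified on
  unbounded sets; exponents are positive because \<open>0 powr 0 = 0\<close>.
\<close>

definition hausdorff_premeasure :: "real \<Rightarrow> real \<Rightarrow> 'a::metric_space set \<Rightarrow> ennreal" where
  "hausdorff_premeasure s d S =
     (INF U\<in>{U :: nat \<Rightarrow> 'a set. S \<subseteq> (\<Union>k. U k) \<and> (\<forall>k. bounded (U k) \<and> diameter (U k) \<le> d)}.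
        \<Sum>k. ennreal (diameter (U k) powr s))"

definition hausdorff_measure :: "real \<Rightarrow> 'a::metric_space set \<Rightarrow> ennreal" where
  "hausdorff_measure s S = (SUP d\<in>{0<..}. hausdorff_premeasure s d S)"

definition hausdorff_dim :: "'a::metric_space set \<Rightarrow> ennreal" where
  "hausdorff_dim S = (INF s\<in>{s. 0 < s \<and> hausdorff_measure s S = 0}. ennreal s)"

text \<open>
  Both dimensions are real ones: \<open>DIM(complex^'e) = 2 * CARD('e)\<close>.
\<close>

definition lower_dimensional :: "'a::euclidean_space set \<Rightarrow> bool" where
  "lower_dimensional S \<longleftrightarrow> hausdorff_dim S < of_nat DIM('a)"

definition almost_all ::
    "('e::finite \<Rightarrow> 'n::finite \<times> 'n) \<Rightarrow> (complex^'e \<Rightarrow> bool) \<Rightarrow> bool" where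
  "almost_all edge P \<longleftrightarrow>
     (\<exists>Z. lower_dimensional Z \<and> (\<forall>x. det (mat 1 - param edge x) \<noteq> 0 \<longrightarrow> x \<notin> Z \<longrightarrow> P x))"

definition almost_no ::
    "('e::finite \<Rightarrow> 'n::finite \<times> 'n) \<Rightarrow> (complex^'e \<Rightarrow> bool) \<Rightarrow> bool" where
  "almost_no edge P \<longleftrightarrow>
     (\<exists>Z. lower_dimensional Z \<and> (\<forall>x. det (mat 1 - param edge x) \<noteq> 0 \<longrightarrow> x \<notin> Z \<longrightarrow> \<not> P x))"

definition generically_locally_identifiable ::
    "('n::finite \<times> 'n) set \<Rightarrow> ('e::finite \<Rightarrow> 'n \<times> 'n) \<Rightarrow> complex^'b^'n \<Rightarrow> complex^'n^'c
      \<Rightarrow> 'n \<Rightarrow> 'n \<Rightarrow> bool" where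
  "generically_locally_identifiable E edge B C i j \<longleftrightarrow>
     almost_all edge (\<lambda>x. locally_identifiable E B C i j (param edge x))"

definition generically_locally_nonidentifiable ::
    "('n::finite \<times> 'n) set \<Rightarrow> ('e::finite \<Rightarrow> 'n \<times> 'n) \<Rightarrow> complex^'b^'n \<Rightarrow> complex^'n^'c
      \<Rightarrow> 'n \<Rightarrow> 'n \<Rightarrow> bool" where
  "generically_locally_nonidentifiable E edge B C i j \<longleftrightarrow>
     almost_no edge (\<lambda>x. locally_identifiable E B C i j (param edge x))"

definition generically_nonidentifiable ::
    "('n::finite \<times> 'n) set \<Rightarrow> ('e::finite \<Rightarrow> 'n \<times> 'n) \<Rightarrow> complex^'b^'n \<Rightarrow> complex^'n^'c
      \<Rightarrow> 'n \<Rightarrow> 'n \<Rightarrow> bool" where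
  "generically_nonidentifiable E edge B C i j \<longleftrightarrow>
     almost_no edge (\<lambda>x. identifiable E B C i j (param edge x))"

end

theory Submission imports Defs begin

text \<open>
  The map \<open>F x = C T(x) B\<close> has derivative \<open>K x\<close>. Choose a minor of \<open>K\<close> of maximal size that is not
  identically zero, with column set \<open>S\<close> and, if possible, with \<open>e \<notin> S\<close>. Up to a power of
  \<open>det (I - G x)\<close> it is a polynomial, so its zero set is lower-dimensional, and off this set the rank of
  \<open>K\<close> is constant. The chosen components of \<open>F\<close>, completed by the coordinates outside \<open>S\<close>,
  therefore form a local chart in which the fibres of \<open>F\<close> are the slices along the coordinates
  outside \<open>S\<close>. If \<open>e \<notin> S\<close>, then \<open>x\<^sub>e\<close> is one of these coordinates and varies in the fibre; and the kernel
  contains a vector with entry \<open>1\<close> at \<open>e\<close>. If \<open>e\<close> belongs to all maximal nonvanishing minors,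
  then an exchange argument gives \<open>ker K \<bottom> e\<close> off the exceptional set, so \<open>x\<^sub>e\<close> has zero derivative
  along the fibres.

  For the dimension of the zero set of a polynomial: a zero at which some partial derivative does not
  vanish has a neighbourhood in which the zeros form a Lipschitz graph, and the zeros of that
  derivative are handled by induction on the degree. The two alternatives exclude each
  other because lower-dimensional sets are Lebesgue null.
\<close>

section \<open>Hausdorff null sets\<close>

text \<open>For null sets the mesh bound costs nothing: a summand below \<open>d powr s\<close>
  already forces its diameter below \<open>d\<close>, so a cover with a small sum is automatically
  fine.\<close>

lemma hausdorff_measure_eq_0_iff:
  fixes S :: "'a::metric_space set"
  assumes s: "0 < s"
  shows "hausdorff_measure s S = 0 \<longleftrightarrow>
    (\<forall>\<epsilon>>0. \<exists>U::nat \<Rightarrow> 'a set. S \<subseteq> (\<Union>k. U k) \<and> (\<forall>k. bounded (U k)) \<and>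
       (\<Sum>k. ennreal (diameter (U k) powr s)) < ennreal \<epsilon>)" (is "?L \<longleftrightarrow> ?R")
proof
  assume L: ?L
  show ?R
  proof (intro allI impI)
    fix \<epsilon> :: real assume "0 < \<epsilon>"
    have "hausdorff_premeasure s 1 S \<le> 0"
      unfolding L[symmetric] hausdorff_measure_def by (rule SUP_upper) simp
    then have "hausdorff_premeasure s 1 S < ennreal \<epsilon>" using \<open>0 < \<epsilon>\<close>
      by (simp add: order_le_less_trans)
    then show "\<exists>U::nat \<Rightarrow> 'a set. S \<subseteq> (\<Union>k. U k) \<and> (\<forall>k. bounded (U k)) \<and>
       (\<Sum>k. ennreal (diameter (U k) powr s)) < ennreal \<epsilon>"
      unfolding hausdorff_premeasure_def INF_less_iff by blast
  qed
next
  assume R: ?R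
  have "hausdorff_premeasure s d S \<le> 0" if d: "0 < d" for d
  proof (rule ennreal_le_epsilon)
    fix \<epsilon> :: real assume \<epsilon>: "0 < \<epsilon>"
    define \<eta> where "\<eta> = min \<epsilon> (d powr s)"
    have "0 < \<eta>" using \<epsilon> d by (simp add: \<eta>_def)
    then obtain U :: "nat \<Rightarrow> 'a set" where U: "S \<subseteq> (\<Union>k. U k)" "\<And>k. bounded (U k)"
      "(\<Sum>k. ennreal (diameter (U k) powr s)) < ennreal \<eta>" using R by blast
    have "diameter (U k) \<le> d" for k
    proof -
      have "(\<Sum>i\<in>{k}. ennreal (diameter (U i) powr s)) \<le> (\<Sum>i. ennreal (diameter (U i) powr s))"
        by (rule sum_le_suminf) auto
      then have "ennreal (diameter (U k) powr s) < ennreal \<eta>" using U(3) by simp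
      then have "diameter (U k) powr s < d powr s"
        by (simp add: ennreal_less_iff \<eta>_def)
      then show ?thesis using s d
        by (meson less_eq_real_def linorder_not_less powr_less_mono2)
    qed
    then have "hausdorff_premeasure s d S \<le> (\<Sum>k. ennreal (diameter (U k) powr s))"
      unfolding hausdorff_premeasure_def using U by (intro INF_lower) auto
    also have "\<dots> \<le> 0 + ennreal \<epsilon>"
      using U(3) by (simp add: \<eta>_def) (meson ennreal_leI less_imp_le min.cobounded1 order_trans)
    finally show "hausdorff_premeasure s d S \<le> 0 + ennreal \<epsilon>" .
  qed
  then show ?L
    unfolding hausdorff_measure_def le_zero_eq[symmetric] by (intro SUP_least) auto
qed

lemma hausdorff_null_mono:
  assumes "0 < s" "hausdorff_measure s T = 0" "S \<subseteq> T"
  shows "hausdorff_measure s S = 0"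
  using assms unfolding hausdorff_measure_eq_0_iff[OF assms(1)] by (meson subset_trans)

lemma hausdorff_null_UN:
  fixes S :: "nat \<Rightarrow> 'a::metric_space set"
  assumes s: "0 < s" and S: "\<And>n. hausdorff_measure s (S n) = 0"
  shows "hausdorff_measure s (\<Union>n. S n) = 0"
  unfolding hausdorff_measure_eq_0_iff[OF s]
proof (intro allI impI)
  fix \<epsilon> :: real assume \<epsilon>: "0 < \<epsilon>"
  \<comment> \<open>The bounds add up to \<open>\<epsilon> / 2\<close> instead of
    \<open>\<epsilon>\<close>, because summing infinitely many strict bounds leaves only a weak
    inequality.\<close>
  have "\<exists>U::nat \<Rightarrow> 'a set. S n \<subseteq> (\<Union>k. U k) \<and> (\<forall>k. bounded (U k)) \<and>
       (\<Sum>k. ennreal (diameter (U k) powr s)) < ennreal (\<epsilon> / 2 * (1/2) ^ Suc n)" for n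
    using S[of n] \<epsilon> unfolding hausdorff_measure_eq_0_iff[OF s] by simp
  then obtain U :: "nat \<Rightarrow> nat \<Rightarrow> 'a set" where U: "\<And>n. S n \<subseteq> (\<Union>k. U n k)" "\<And>n k. bounded (U n k)"
    "\<And>n. (\<Sum>k. ennreal (diameter (U n k) powr s)) < ennreal (\<epsilon> / 2 * (1/2) ^ Suc n)"
    by metis
  define V where "V = (\<lambda>m. case prod_decode m of (n, k) \<Rightarrow> U n k)"
  have "(\<Sum>m. ennreal (diameter (V m) powr s))
      = (\<Sum>m. (\<lambda>(n, k). ennreal (diameter (U n k) powr s)) (prod_decode m))"
    by (simp add: V_def case_prod_unfold)
  also have "\<dots> = (\<Sum>n. \<Sum>k. ennreal (diameter (U n k) powr s))"
    by (rule suminf_ennreal_2dimen) simp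
  also have "\<dots> \<le> (\<Sum>n. ennreal (\<epsilon> / 2 * (1/2) ^ Suc n))"
    using U(3) by (intro suminf_le less_imp_le) auto
  also have "\<dots> = ennreal (\<epsilon> / 2)"
    using sums_mult[OF power_half_series, of "\<epsilon> / 2"] \<epsilon>
    by (intro suminf_ennreal_eq) auto
  also have "\<dots> < ennreal \<epsilon>" using \<epsilon> by (simp add: ennreal_less_iff)
  finally have "(\<Sum>m. ennreal (diameter (V m) powr s)) < ennreal \<epsilon>" .
  moreover have "(\<Union>n. S n) \<subseteq> (\<Union>m. V m)"
  proof
    fix x assume "x \<in> (\<Union>n. S n)"
    then obtain n k where "x \<in> U n k" using U(1) by blast
    then have "x \<in> V (prod_encode (n, k))" by (simp add: V_def)
    then show "x \<in> (\<Union>m. V m)" by blast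
  qed
  moreover have "bounded (V m)" for m by (simp add: V_def U(2) case_prod_unfold)
  ultimately show "\<exists>U::nat \<Rightarrow> 'a set. (\<Union>n. S n) \<subseteq> (\<Union>k. U k) \<and> (\<forall>k. bounded (U k)) \<and>
       (\<Sum>k. ennreal (diameter (U k) powr s)) < ennreal \<epsilon>" by blast
qed

lemma hausdorff_null_countable_Union:
  assumes s: "0 < s" and "countable \<F>" and null: "\<And>S. S \<in> \<F> \<Longrightarrow> hausdorff_measure s S = 0"
  shows "hausdorff_measure s (\<Union>\<F>) = 0"
proof (cases "\<F> = {}")
  case True
  have "diameter ({} :: 'a set) powr s = 0" by simp
  then have "hausdorff_measure s ({} :: 'a set) = 0"
    unfolding hausdorff_measure_eq_0_iff[OF s]
    by (intro allI impI exI[of _ "\<lambda>_. {}"]) simp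
  then show ?thesis using True by simp
next
  case False
  then have "\<F> = range (from_nat_into \<F>)" using \<open>countable \<F>\<close> by simp
  then have "\<Union>\<F> = (\<Union>n. from_nat_into \<F> n)" by simp
  then show ?thesis using hausdorff_null_UN[OF s] null False from_nat_into by metis
qed

text \<open>Padding a finite cover with empty sets gives a sequence with the same sum, since
  \<open>diameter {} = 0\<close> and \<open>0 powr s = 0\<close>.\<close>

lemma hausdorff_null_finite_cover:
  fixes S :: "'a::metric_space set"
  assumes s: "0 < s"
    and cover: "\<And>\<epsilon>. 0 < \<epsilon> \<Longrightarrow> \<exists>\<V>. finite \<V> \<and> S \<subseteq> \<Union>\<V> \<and> (\<forall>V\<in>\<V>. bounded V) \<and>
       (\<Sum>V\<in>\<V>. diameter V powr s) < \<epsilon>"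
  shows "hausdorff_measure s S = 0"
  unfolding hausdorff_measure_eq_0_iff[OF s]
proof (intro allI impI)
  fix \<epsilon> :: real assume "0 < \<epsilon>"
  then obtain \<V> where \<V>: "finite \<V>" "S \<subseteq> \<Union>\<V>" "\<forall>V\<in>\<V>. bounded V" "(\<Sum>V\<in>\<V>. diameter V powr s) < \<epsilon>"
    using cover by blast
  obtain h where h: "bij_betw h {..<card \<V>} \<V>"
    using ex_bij_betw_nat_finite[OF \<V>(1)] by (auto simp: atLeast0LessThan)
  define U where "U = (\<lambda>k. if k < card \<V> then h k else {})"
  have img: "h ` {..<card \<V>} = \<V>" using h by (simp add: bij_betw_def)
  have "(\<Sum>k. ennreal (diameter (U k) powr s)) = (\<Sum>k<card \<V>. ennreal (diameter (U k) powr s))"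
    by (rule suminf_finite) (auto simp: U_def)
  also have "\<dots> = (\<Sum>k<card \<V>. ennreal (diameter (h k) powr s))"
    by (rule sum.cong) (auto simp: U_def)
  also have "\<dots> = (\<Sum>V\<in>\<V>. ennreal (diameter V powr s))"
    by (rule sum.reindex_bij_betw[OF h])
  also have "\<dots> = ennreal (\<Sum>V\<in>\<V>. diameter V powr s)" by (simp add: sum_ennreal)
  also have "\<dots> < ennreal \<epsilon>" using \<V>(4) \<open>0 < \<epsilon>\<close> by (simp add: ennreal_lessI)
  finally have "(\<Sum>k. ennreal (diameter (U k) powr s)) < ennreal \<epsilon>" .
  moreover have "S \<subseteq> (\<Union>k. U k)"
  proof
    fix x assume "x \<in> S"
    then obtain k where "k < card \<V>" "x \<in> h k" using \<V>(2) img by blast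
    then show "x \<in> (\<Union>k. U k)" by (auto simp: U_def intro!: exI[of _ k])
  qed
  moreover have "bounded (U k)" for k using img \<V>(3) by (auto simp: U_def)
  ultimately show "\<exists>U::nat \<Rightarrow> 'a set. S \<subseteq> (\<Union>k. U k) \<and> (\<forall>k. bounded (U k)) \<and>
       (\<Sum>k. ennreal (diameter (U k) powr s)) < ennreal \<epsilon>" by blast
qed

text \<open>
  The condition on \<open>P\<close> says that the projection along \<open>b\<close> is injective on \<open>P\<close> with Lipschitz inverse.
  The covering sets are the parts of \<open>P\<close> over the cells of a grid of mesh \<open>1/m\<close> in the hyperplane
  orthogonal to \<open>b\<close>.
\<close>

lemma hausdorff_null_Lipschitz_graph:
  fixes P :: "'a::euclidean_space set"
  assumes s: "real DIM('a) - 1 < s" and "bounded P" and b: "b \<in> Basis"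
    and L: "\<And>x y. x \<in> P \<Longrightarrow> y \<in> P \<Longrightarrow> norm (x - y) \<le> L * (\<Sum>i\<in>Basis - {b}. \<bar>(x - y) \<bullet> i\<bar>)"
  shows "hausdorff_measure s P = 0"
proof (rule hausdorff_null_finite_cover)
  let ?B = "Basis - {b}" and ?D = "DIM('a) - 1"
  have D: "real ?D = real DIM('a) - 1" by (simp add: of_nat_diff Suc_leI)
  show "0 < s" using s D by linarith
  fix \<epsilon> :: real assume "0 < \<epsilon>"
  obtain K0 where K0: "\<And>x. x \<in> P \<Longrightarrow> norm x \<le> K0" using \<open>bounded P\<close> bounded_iff by blast
  define K where "K = nat \<lceil>\<bar>K0\<bar>\<rceil> + 1"
  have K: "\<bar>x \<bullet> i\<bar> \<le> real K" if "x \<in> P" "i \<in> Basis" for x i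
  proof -
    have "\<bar>x \<bullet> i\<bar> \<le> \<bar>K0\<bar>" using Basis_le_norm[OF that(2), of x] K0[OF that(1)] by linarith
    then show ?thesis by (simp add: K_def) linarith
  qed
  \<comment> \<open>Mesh \<open>1/m\<close> yields at most \<open>(4 * K * m) ^ ?D\<close> cells,
    and the part of \<open>P\<close> over each has diameter at most
    \<open>\<bar>L\<bar> * ?D / m\<close>. The sum is thus at most
    \<open>c * m powr (?D - s)\<close>, which tends to 0 because \<open>s\<close> exceeds
    \<open>?D\<close>.\<close>
  define c where "c = (4 * real K) ^ ?D * (\<bar>L\<bar> * ?D) powr s"
  have "(\<lambda>m. c * real m powr (real ?D - s)) \<longlonglongrightarrow> c * 0"
  proof (intro tendsto_mult tendsto_const)
    have "((\<lambda>x::real. x powr (real ?D - s)) \<longlongrightarrow> 0) at_top"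
      using s D by (intro tendsto_neg_powr filterlim_ident) linarith
    then show "(\<lambda>m. real m powr (real ?D - s)) \<longlonglongrightarrow> 0"
      by (rule filterlim_compose[OF _ filterlim_real_sequentially])
  qed
  then have "\<forall>\<^sub>F m in sequentially. c * real m powr (real ?D - s) < \<epsilon>"
    using \<open>0 < \<epsilon>\<close> by (intro order_tendstoD(2)[of _ "c * 0"]) auto
  moreover have "\<forall>\<^sub>F m in sequentially. 0 < m" by (rule eventually_gt_at_top)
  ultimately obtain m where m: "c * real m powr (real ?D - s) < \<epsilon>" "0 < m"
    using eventually_happens[OF eventually_conj] by (metis (mono_tags, lifting) sequentially_bot)
  \<comment> \<open>The index of the cell below a point: all coordinates except the one along
    \<open>b\<close>, scaled and rounded down. The restriction puts the indices into the finite
    function space \<open>Q\<close>.\<close>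
  define q where "q = (\<lambda>x. restrict (\<lambda>i. \<lfloor>real m * (x \<bullet> i)\<rfloor>) ?B)"
  define Q where "Q = (?B \<rightarrow>\<^sub>E {- int (K * m)..int (K * m)})"
  have "finite Q" by (simp add: Q_def finite_PiE)
  have qQ: "q ` P \<subseteq> Q"
  proof
    fix f assume "f \<in> q ` P"
    then obtain x where x: "x \<in> P" "f = q x" by blast
    have "\<lfloor>real m * (x \<bullet> i)\<rfloor> \<in> {- int (K * m)..int (K * m)}" if "i \<in> ?B" for i
    proof -
      have "\<bar>real m * (x \<bullet> i)\<bar> \<le> real m * real K"
        using K[of x i] x that by (simp add: abs_mult mult_left_mono)
      then have "real_of_int (- int (K * m)) \<le> real m * (x \<bullet> i)" "real m * (x \<bullet> i) \<le> real_of_int (int (K * m))"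
        by (auto simp: mult.commute abs_le_iff)
      then show ?thesis by (simp add: le_floor_iff floor_le_iff)
    qed
    then show "f \<in> Q" by (simp add: x(2) Q_def q_def)
  qed
  have fin: "finite (q ` P)" using qQ \<open>finite Q\<close> finite_subset by blast
  have "card (q ` P) \<le> card Q" using qQ \<open>finite Q\<close> card_mono by blast
  also have "card Q = nat (2 * int (K * m) + 1) ^ ?D"
    using b by (simp add: Q_def card_PiE card_Diff_subset)
  also have "nat (2 * int (K * m) + 1) = 2 * (K * m) + 1" by (metis int_ops(2,3,7) nat_int of_nat_add)
  also have "(2 * (K * m) + 1) ^ ?D \<le> (4 * K * m) ^ ?D"
  proof (rule power_mono)
    have "1 \<le> K * m" using \<open>0 < m\<close> by (simp add: K_def)
    then show "2 * (K * m) + 1 \<le> 4 * K * m" by (simp only: mult.assoc)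
  qed simp
  finally have "card (q ` P) \<le> (4 * K * m) ^ ?D" .
  then have card: "real (card (q ` P)) \<le> (4 * real K) ^ ?D * real m ^ ?D"
    by (metis (mono_tags, lifting) of_nat_le_iff of_nat_mult of_nat_numeral of_nat_power power_mult_distrib)
  define V where "V = (\<lambda>f. {x \<in> P. q x = f})"
  have diam: "diameter (V f) \<le> \<bar>L\<bar> * ?D / m" for f
  proof (rule diameter_le)
    show "V f \<noteq> {} \<or> 0 \<le> \<bar>L\<bar> * ?D / m" by simp
    fix x y assume xy: "x \<in> V f" "y \<in> V f"
    have "\<bar>(x - y) \<bullet> i\<bar> \<le> 1 / m" if "i \<in> ?B" for i
    proof -
      have "q x i = q y i" using xy by (simp add: V_def)
      then have "\<lfloor>real m * (x \<bullet> i)\<rfloor> = \<lfloor>real m * (y \<bullet> i)\<rfloor>" using that by (simp add: q_def)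
      then have "\<bar>real m * (x \<bullet> i) - real m * (y \<bullet> i)\<bar> \<le> 1" by linarith
      then have "real m * \<bar>(x - y) \<bullet> i\<bar> \<le> 1"
        by (metis abs_mult abs_of_nat inner_diff_left right_diff_distrib)
      then show ?thesis using \<open>0 < m\<close> by (simp add: field_simps)
    qed
    then have "(\<Sum>i\<in>?B. \<bar>(x - y) \<bullet> i\<bar>) \<le> (\<Sum>i\<in>?B. 1 / m)" by (rule sum_mono)
    also have "\<dots> = ?D / m" using b by (simp add: card_Diff_subset)
    finally have S: "(\<Sum>i\<in>?B. \<bar>(x - y) \<bullet> i\<bar>) \<le> ?D / m" .
    have "norm (x - y) \<le> L * (\<Sum>i\<in>?B. \<bar>(x - y) \<bullet> i\<bar>)" using L xy by (simp add: V_def)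
    also have "\<dots> \<le> \<bar>L\<bar> * (?D / m)"
      using S by (intro mult_mono) (auto intro: sum_nonneg)
    finally show "norm (x - y) \<le> \<bar>L\<bar> * ?D / m" by simp
  qed
  have bnd: "bounded (V f)" for f
    using \<open>bounded P\<close> by (rule bounded_subset) (auto simp: V_def)
  have "(\<Sum>W\<in>V ` q ` P. diameter W powr s) \<le> (\<Sum>W\<in>V ` q ` P. (\<bar>L\<bar> * ?D / m) powr s)"
    using diam bnd \<open>0 < s\<close> by (intro sum_mono powr_mono2) (auto intro: diameter_ge_0)
  also have "\<dots> \<le> card (q ` P) * (\<bar>L\<bar> * ?D / m) powr s"
    using card_image_le[OF fin, of V] by (simp add: mult_right_mono)
  also have "\<dots> \<le> ((4 * real K) ^ ?D * real m ^ ?D) * (\<bar>L\<bar> * ?D / m) powr s"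
    using card by (rule mult_right_mono) simp
  also have "\<dots> = c * (real m ^ ?D / real m powr s)"
    by (simp add: c_def powr_divide)
  also have "real m ^ ?D / real m powr s = real m powr (real ?D - s)"
    using \<open>0 < m\<close> by (simp add: powr_diff powr_realpow del: of_nat_diff)
  finally have "(\<Sum>W\<in>V ` q ` P. diameter W powr s) < \<epsilon>" using m(1) by linarith
  then show "\<exists>\<V>. finite \<V> \<and> P \<subseteq> \<Union>\<V> \<and> (\<forall>V\<in>\<V>. bounded V) \<and> (\<Sum>V\<in>\<V>. diameter V powr s) < \<epsilon>"
    using fin bnd by (intro exI[of _ "V ` q ` P"]) (auto simp: V_def)
qed

text \<open>A set of diameter \<open>d\<close> \<le> 1 lies in a cube of volume
  \<open>(2 * d) ^ n\<close>, which is at most \<open>2 ^ n * d powr s\<close> for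
  \<open>s < n\<close>. Nullity for such an exponent \<open>s\<close> therefore gives covers by
  cubes of arbitrarily small total volume.\<close>

lemma lower_dimensional_imp_negligible:
  fixes Z :: "'a::euclidean_space set"
  assumes "lower_dimensional Z"
  shows "negligible Z"
proof -
  let ?n = "DIM('a)"
  obtain s where s: "0 < s" "hausdorff_measure s Z = 0" "ennreal s < of_nat ?n"
    using assms unfolding lower_dimensional_def hausdorff_dim_def INF_less_iff by blast
  have sn: "s < real ?n" using s by (simp add: ennreal_of_nat_eq_real_of_nat ennreal_less_iff)
  show ?thesis unfolding negligible_outer_le
  proof (intro allI impI)
    fix \<epsilon> :: real assume \<epsilon>: "0 < \<epsilon>"
    \<comment> \<open>The bound 1 keeps all diameters in the range where \<open>d ^ ?n\<close> is at
      most \<open>d powr s\<close>; dividing by \<open>2 ^ ?n\<close> pays for the passage to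
      cubes.\<close>
    define \<eta> where "\<eta> = min 1 (\<epsilon> / 2 ^ ?n)"
    have "0 < \<eta>" using \<epsilon> by (simp add: \<eta>_def)
    then obtain U :: "nat \<Rightarrow> 'a set" where U: "Z \<subseteq> (\<Union>k. U k)" "\<And>k. bounded (U k)"
      "(\<Sum>k. ennreal (diameter (U k) powr s)) < ennreal \<eta>"
      using s(2) unfolding hausdorff_measure_eq_0_iff[OF s(1)] by meson
    define d where "d = (\<lambda>k. diameter (U k))"
    have d0: "0 \<le> d k" for k using U(2) by (simp add: d_def diameter_ge_0)
    have d1: "d k \<le> 1" for k
    proof -
      have "(\<Sum>i\<in>{k}. ennreal (d i powr s)) \<le> (\<Sum>i. ennreal (d i powr s))"
        by (rule sum_le_suminf) auto
      then have "ennreal (d k powr s) < ennreal \<eta>" using U(3) by (simp add: d_def)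
      then have "d k powr s < 1 powr s"
        by (simp add: ennreal_less_iff \<eta>_def)
      then show ?thesis using s(1)
        by (metis less_eq_real_def linorder_not_less powr_less_mono2 zero_le_one)
    qed
    have dn: "d k ^ ?n \<le> d k powr s" for k
    proof (cases "d k = 0")
      case False
      then have "d k ^ ?n = d k powr ?n" using d0[of k] by (simp add: powr_realpow)
      also have "\<dots> \<le> d k powr s" using sn d0 d1 False by (intro powr_mono') auto
      finally show ?thesis .
    qed (simp add: zero_power)
    \<comment> \<open>For empty \<open>U k\<close> the point \<open>p k\<close> is arbitrary, which
      is harmless: its cube is then a single point.\<close>
    define p where "p = (\<lambda>k. SOME x. x \<in> U k)"
    define T where "T = (\<lambda>k. cbox (p k - d k *\<^sub>R One) (p k + d k *\<^sub>R One))"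
    have UT: "U k \<subseteq> T k" for k
    proof
      fix x assume x: "x \<in> U k"
      then have "p k \<in> U k" unfolding p_def by (rule someI)
      then have "dist x (p k) \<le> d k" using U(2) x diameter_bounded_bound unfolding d_def by blast
      then have "\<bar>(x - p k) \<bullet> i\<bar> \<le> d k" if "i \<in> Basis" for i
        using Basis_le_norm[OF that, of "x - p k"] by (simp add: dist_norm)
      then show "x \<in> T k" unfolding T_def mem_box
        by (auto simp: inner_diff_left inner_add_left abs_le_iff) (smt (verit, best))+
    qed
    have eT: "emeasure lebesgue (T k) \<le> ennreal (2 ^ ?n * d k powr s)" for k
    proof -
      have "emeasure lborel (T k) = ennreal (\<Prod>i\<in>(Basis::'a set). 2 * d k)"
        using d0[of k] unfolding T_def
        by (subst emeasure_lborel_cbox) (auto simp: inner_diff_left inner_add_left intro!: prod.cong)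
      also have "\<dots> \<le> ennreal (2 ^ ?n * d k powr s)"
        using dn[of k] by (auto simp: power_mult_distrib intro!: ennreal_leI)
      finally show ?thesis by (simp add: T_def)
    qed
    have "emeasure lebesgue (\<Union>k. T k) \<le> (\<Sum>k. emeasure lebesgue (T k))"
      by (rule emeasure_subadditive_countably) (auto simp: T_def)
    also have "\<dots> \<le> (\<Sum>k. ennreal (2 ^ ?n) * ennreal (d k powr s))"
      using eT by (intro suminf_le) (auto simp: ennreal_mult')
    also have "\<dots> = ennreal (2 ^ ?n) * (\<Sum>k. ennreal (d k powr s))" by simp
    also have "\<dots> \<le> ennreal (2 ^ ?n) * ennreal \<eta>"
      using U(3) by (intro mult_left_mono) (auto simp: d_def)
    also have "\<dots> = ennreal (2 ^ ?n * \<eta>)" by (simp add: ennreal_mult')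
    also have "\<dots> \<le> ennreal \<epsilon>"
      by (intro ennreal_leI) (simp add: \<eta>_def min_def field_simps)
    finally have le: "emeasure lebesgue (\<Union>k. T k) \<le> ennreal \<epsilon>" .
    have meas: "(\<Union>k. T k) \<in> sets lebesgue" by (auto simp: T_def)
    then have "(\<Union>k. T k) \<in> lmeasurable"
      using le by (intro fmeasurableI) (auto intro: order_le_less_trans)
    moreover have "measure lebesgue (\<Union>k. T k) \<le> \<epsilon>"
      using le \<epsilon> by (simp add: measure_def enn2real_leI)
    moreover have "Z \<subseteq> (\<Union>k. T k)" using U(1) UT by blast
    ultimately show "\<exists>T. Z \<subseteq> T \<and> T \<in> lmeasurable \<and> measure lebesgue T \<le> \<epsilon>" by blast
  qed
qed

section \<open>Zero sets of polynomials\<close>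

text \<open>A coefficient-free form of "polynomial of degree less than n": all partial derivatives
  of order \<open>n\<close> vanish identically. The function \<open>g b\<close> is the partial
  derivative along \<open>b\<close>, to which inductions on the degree pass.\<close>

primrec derivs_vanish :: "nat \<Rightarrow> ('a::euclidean_space \<Rightarrow> real) \<Rightarrow> bool" where
  "derivs_vanish 0 f \<longleftrightarrow> f = (\<lambda>x. 0)"
| "derivs_vanish (Suc n) f \<longleftrightarrow>
     (\<exists>g. (\<forall>b\<in>Basis. derivs_vanish n (g b)) \<and>
          (\<forall>x. (f has_derivative (\<lambda>h. \<Sum>b\<in>Basis. (h \<bullet> b) * g b x)) (at x)))"

lemma derivs_vanish_zero: "derivs_vanish n (\<lambda>x. 0)"
  by (induction n) (auto intro!: exI[of _ "\<lambda>b x. 0"])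

lemma derivs_vanish_Suc: "derivs_vanish n f \<Longrightarrow> derivs_vanish (Suc n) f"
proof (induction n arbitrary: f)
  case 0
  then show ?case using derivs_vanish_zero[of "Suc 0"] by (simp only: derivs_vanish.simps(1))
next
  case (Suc n)
  then obtain g where "\<forall>b\<in>Basis. derivs_vanish n (g b)"
    "\<forall>x. (f has_derivative (\<lambda>h. \<Sum>b\<in>Basis. (h \<bullet> b) * g b x)) (at x)" by auto
  then show ?case using Suc.IH by (subst derivs_vanish.simps(2)) blast
qed

lemma derivs_vanish_mono: "m \<le> n \<Longrightarrow> derivs_vanish m f \<Longrightarrow> derivs_vanish n f"
  by (induction rule: dec_induct) (assumption, rule derivs_vanish_Suc)

lemma derivs_vanish_add:
  "derivs_vanish n f \<Longrightarrow> derivs_vanish n g \<Longrightarrow> derivs_vanish n (\<lambda>x. f x + g x)"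
proof (induction n arbitrary: f g)
  case (Suc n)
  obtain f' g' where D: "\<forall>b\<in>Basis. derivs_vanish n (f' b)" "\<forall>b\<in>Basis. derivs_vanish n (g' b)"
    "\<And>x. (f has_derivative (\<lambda>h. \<Sum>b\<in>Basis. (h \<bullet> b) * f' b x)) (at x)"
    "\<And>x. (g has_derivative (\<lambda>h. \<Sum>b\<in>Basis. (h \<bullet> b) * g' b x)) (at x)"
    using Suc.prems by auto
  have "((\<lambda>x. f x + g x) has_derivative (\<lambda>h. \<Sum>b\<in>Basis. (h \<bullet> b) * (f' b x + g' b x))) (at x)" for x
    using has_derivative_add[OF D(3,4)] by (simp add: distrib_left sum.distrib)
  then show ?case using Suc.IH D(1,2) by (auto intro!: exI[of _ "\<lambda>b x. f' b x + g' b x"])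
qed simp

text \<open>In the product rule each term lowers the order of exactly one factor, hence the
  induction on \<open>m + n\<close>. If one of the orders is 0, the product is the zero
  function.\<close>

lemma derivs_vanish_mult:
  "derivs_vanish m f \<Longrightarrow> derivs_vanish n g \<Longrightarrow> derivs_vanish (m + n) (\<lambda>x. f x * g x)"
proof (induction "m + n" arbitrary: m n f g)
  case (Suc k)
  show ?case
  proof (cases "m = 0 \<or> n = 0")
    case True
    then have "(\<lambda>x. f x * g x) = (\<lambda>x. 0)" using Suc.prems by auto
    then show ?thesis by (simp only: derivs_vanish_zero)
  next
    case False
    then obtain m' n' where mn: "m = Suc m'" "n = Suc n'" by (meson not0_implies_Suc)
    obtain f' g' where D: "\<forall>b\<in>Basis. derivs_vanish m' (f' b)" "\<forall>b\<in>Basis. derivs_vanish n' (g' b)"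
      "\<And>x. (f has_derivative (\<lambda>h. \<Sum>b\<in>Basis. (h \<bullet> b) * f' b x)) (at x)"
      "\<And>x. (g has_derivative (\<lambda>h. \<Sum>b\<in>Basis. (h \<bullet> b) * g' b x)) (at x)"
      using Suc.prems mn by auto
    have k: "k = m' + n" "k = m + n'" "m + n = Suc k" using Suc.hyps(2) mn by auto
    have "derivs_vanish k (\<lambda>x. f x * g' b x + f' b x * g x)" if "b \<in> Basis" for b
    proof (rule derivs_vanish_add)
      show "derivs_vanish k (\<lambda>x. f x * g' b x)"
        unfolding k(2) using D(2) Suc.prems(1) that by (intro Suc.hyps(1)[OF k(2)]) blast+
      show "derivs_vanish k (\<lambda>x. f' b x * g x)"
        unfolding k(1) using D(1) Suc.prems(2) that by (intro Suc.hyps(1)[OF k(1)]) blast+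
    qed
    moreover have "((\<lambda>x. f x * g x) has_derivative
        (\<lambda>h. \<Sum>b\<in>Basis. (h \<bullet> b) * (f x * g' b x + f' b x * g x))) (at x)" for x
      using has_derivative_mult[OF D(3,4)]
      by (simp add: distrib_left sum.distrib sum_distrib_left sum_distrib_right mult_ac)
    ultimately show ?thesis unfolding k(3) by (auto intro!: exI[of _ "\<lambda>b x. f x * g' b x + f' b x * g x"])
  qed
qed simp

lemma real_polynomial_function_imp_derivs_vanish:
  fixes f :: "'a::euclidean_space \<Rightarrow> real"
  assumes "real_polynomial_function f"
  shows "\<exists>n. derivs_vanish n f"
  using assms
proof induction
  case f: (linear f)
  interpret bounded_linear f by (rule f)
  \<comment> \<open>The partial derivatives of a linear map are the constants \<open>f b\<close>, so
    a linear map has order 2.\<close>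
  have c: "derivs_vanish 1 (\<lambda>x::'a. c)" for c :: real
    by (auto intro!: exI[of _ "\<lambda>b x. 0"])
  have "f h = (\<Sum>b\<in>Basis. (h \<bullet> b) * f b)" for h
    by (subst euclidean_representation[of h, symmetric]) (simp only: sum scaleR real_scaleR_def)
  then have "f = (\<lambda>h. \<Sum>b\<in>Basis. (h \<bullet> b) * f b)" by blast
  then have "(f has_derivative (\<lambda>h. \<Sum>b\<in>Basis. (h \<bullet> b) * f b)) (at x)" for x
    using bounded_linear_imp_has_derivative[OF f, of "at x"] by metis
  then have "derivs_vanish (Suc 1) f"
    using c by (subst derivs_vanish.simps(2), intro exI[of _ "\<lambda>b x. f b"]) auto
  then show ?case by blast
next
  case (const c)
  have "derivs_vanish 1 (\<lambda>x::'a. c)" by (auto intro!: exI[of _ "\<lambda>b x. 0"])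
  then show ?case by blast
next
  case (add f g)
  then obtain m n where "derivs_vanish m f" "derivs_vanish n g" by blast
  then have "derivs_vanish (max m n) f" "derivs_vanish (max m n) g"
    using derivs_vanish_mono max.cobounded1 max.cobounded2 by metis+
  then show ?case using derivs_vanish_add by blast
next
  case (mult f g)
  then show ?case using derivs_vanish_mult by blast
qed

text \<open>The mean value theorem does the work of the implicit function theorem: for two zeros
  near a point where \<open>g b\<close> is nonzero, it bounds the component of their difference
  along \<open>b\<close> by the other components, so the zeros locally form a Lipschitz graph. By
  Lindelof's theorem countably many such neighbourhoods suffice.\<close>

lemma hausdorff_null_regular_zeros:
  fixes f :: "'a::euclidean_space \<Rightarrow> real"
  assumes s: "real DIM('a) - 1 < s"
    and f: "\<And>x. (f has_derivative (\<lambda>h. \<Sum>b\<in>Basis. (h \<bullet> b) * g b x)) (at x)"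
    and g: "\<And>b. b \<in> Basis \<Longrightarrow> continuous_on UNIV (g b)"
    and b: "b \<in> Basis"
  shows "hausdorff_measure s {x. f x = 0 \<and> g b x \<noteq> 0} = 0"
proof -
  let ?Z = "{x. f x = 0 \<and> g b x \<noteq> 0}"
  have s0: "0 < s" using s of_nat_mono[OF DIM_ge_Suc0[where 'a='a], where 'a=real] by linarith
  have loc: "\<exists>r>0. hausdorff_measure s (?Z \<inter> ball a r) = 0" if a: "a \<in> ?Z" for a
  proof -
    \<comment> \<open>By continuity, near \<open>a\<close> the modulus of \<open>g b\<close> stays
      above \<open>c\<close> and those of all partial derivatives stay below \<open>M\<close>; this
      makes \<open>1 + M / c\<close> a Lipschitz constant.\<close>
    define c where "c = \<bar>g b a\<bar> / 2"
    define M where "M = (\<Sum>i\<in>Basis. \<bar>g i a\<bar>) + 1"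
    have c0: "0 < c" using a by (simp add: c_def)
    have ev: "\<forall>\<^sub>F x in nhds a. c < \<bar>g b x\<bar> \<and> (\<forall>i\<in>Basis. \<bar>g i x\<bar> < M)"
    proof (intro eventually_conj eventually_ball_finite ballI)
      have lim: "((\<lambda>x. \<bar>g i x\<bar>) \<longlongrightarrow> \<bar>g i a\<bar>) (nhds a)" if "i \<in> Basis" for i
        using g[OF that] by (intro tendsto_rabs) (simp add: continuous_on_eq_continuous_at isCont_def tendsto_nhds_iff)
      show "\<forall>\<^sub>F x in nhds a. c < \<bar>g b x\<bar>"
        using lim[OF b] by (rule order_tendstoD(1)) (use c0 c_def in linarith)
      fix i :: 'a assume i: "i \<in> Basis"
      have "\<bar>g i a\<bar> \<le> (\<Sum>i\<in>Basis. \<bar>g i a\<bar>)" using i by (intro member_le_sum) auto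
      then show "\<forall>\<^sub>F x in nhds a. \<bar>g i x\<bar> < M"
        using lim[OF i] by (intro order_tendstoD(2)) (auto simp: M_def)
    qed simp
    then obtain r where r: "0 < r" "\<And>x. dist x a < r \<Longrightarrow> c < \<bar>g b x\<bar> \<and> (\<forall>i\<in>Basis. \<bar>g i x\<bar> < M)"
      unfolding eventually_nhds_metric by blast
    have "hausdorff_measure s (?Z \<inter> ball a r) = 0"
    proof (rule hausdorff_null_Lipschitz_graph[OF s _ b, where L = "1 + M / c"])
      show "bounded (?Z \<inter> ball a r)" using bounded_ball bounded_subset by blast
      fix x y assume x: "x \<in> ?Z \<inter> ball a r" and y: "y \<in> ?Z \<inter> ball a r"
      define w where "w = (\<lambda>i. (x - y) \<bullet> i)"
      define S where "S = (\<Sum>i\<in>Basis - {b}. \<bar>w i\<bar>)"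
      have "\<exists>\<xi>\<in>ball a r. f x - f y = (\<Sum>i\<in>Basis. w i * g i \<xi>)"
      proof -
        have "\<exists>z\<in>closed_segment y x. f x - f y = (\<Sum>i\<in>Basis. ((x - y) \<bullet> i) * g i z)"
        proof -
          define F F' where "F = (\<lambda>t. f (y + t *\<^sub>R (x - y)))"
            and "F' = (\<lambda>t h. \<Sum>i\<in>Basis. ((h *\<^sub>R (x - y)) \<bullet> i) * g i (y + t *\<^sub>R (x - y)))"
          have "(F has_derivative F' t) (at t within {0..1})" for t :: real
            unfolding F_def F'_def
            by (rule has_derivative_compose[of "\<lambda>t. y + t *\<^sub>R (x - y)" "\<lambda>h. h *\<^sub>R (x - y)"])
               (auto intro!: derivative_eq_intros f)
          then obtain t where t: "t \<in> {0<..<1::real}" "F 1 - F 0 = F' t (1 - 0)"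
            using mvt_simple[of 0 1 F F'] by (metis zero_less_one)
          have "y + t *\<^sub>R (x - y) \<in> closed_segment y x"
            using t(1) unfolding in_segment by (intro exI[of _ t]) (simp add: algebra_simps)
          with t(2) show ?thesis unfolding F_def F'_def by (intro bexI) auto
        qed
        moreover have "closed_segment y x \<subseteq> ball a r"
          using x y by (intro closed_segment_subset) auto
        ultimately show ?thesis unfolding w_def by blast
      qed
      then obtain \<xi> where \<xi>: "\<xi> \<in> ball a r" "f x - f y = (\<Sum>i\<in>Basis. w i * g i \<xi>)" by blast
      then have "0 = w b * g b \<xi> + (\<Sum>i\<in>Basis - {b}. w i * g i \<xi>)"
        using x y b by (simp add: sum.remove)
      then have "\<bar>w b\<bar> * \<bar>g b \<xi>\<bar> = \<bar>\<Sum>i\<in>Basis - {b}. w i * g i \<xi>\<bar>"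
        by (simp flip: abs_mult)
      also have "\<dots> \<le> (\<Sum>i\<in>Basis - {b}. \<bar>w i\<bar> * M)"
        using r(2)[of \<xi>] \<xi>(1)
        by (intro order_trans[OF sum_abs] sum_mono)
           (auto simp: abs_mult dist_commute less_imp_le intro!: mult_left_mono)
      also have "\<dots> = M * S" by (simp add: S_def sum_distrib_left mult.commute)
      finally have "\<bar>w b\<bar> * \<bar>g b \<xi>\<bar> \<le> M * S" .
      moreover have "\<bar>w b\<bar> * c \<le> \<bar>w b\<bar> * \<bar>g b \<xi>\<bar>"
        using r(2)[of \<xi>] \<xi>(1) by (intro mult_left_mono) (auto simp: dist_commute less_imp_le)
      ultimately have wb: "\<bar>w b\<bar> \<le> M * S / c" using c0 by (simp add: field_simps)
      have "norm (x - y) \<le> (\<Sum>i\<in>Basis. \<bar>w i\<bar>)" unfolding w_def by (rule norm_le_l1)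
      also have "\<dots> = \<bar>w b\<bar> + S" using b by (simp add: sum.remove S_def)
      also have "\<dots> \<le> (1 + M / c) * S" using wb by (simp add: algebra_simps)
      finally show "norm (x - y) \<le> (1 + M / c) * (\<Sum>i\<in>Basis - {b}. \<bar>(x - y) \<bullet> i\<bar>)"
        by (simp add: S_def w_def)
    qed
    then show ?thesis using r(1) by blast
  qed
  then have "\<forall>a\<in>?Z. \<exists>r>0. hausdorff_measure s (?Z \<inter> ball a r) = 0" by blast
  from bchoice[OF this] obtain r where
    r: "\<And>a. a \<in> ?Z \<Longrightarrow> 0 < r a" "\<And>a. a \<in> ?Z \<Longrightarrow> hausdorff_measure s (?Z \<inter> ball a (r a)) = 0"
    by blast
  define \<B> where "\<B> = (\<lambda>a. ball a (r a)) ` ?Z"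
  obtain \<B>' where \<B>': "\<B>' \<subseteq> \<B>" "countable \<B>'" "\<Union>\<B>' = \<Union>\<B>"
    using Lindelof[of \<B>] by (auto simp: \<B>_def)
  have "?Z \<subseteq> \<Union>\<B>" using r(1) by (force simp: \<B>_def)
  then have "?Z \<subseteq> \<Union>((\<inter>) ?Z ` \<B>')" using \<B>'(3) by blast
  moreover have "hausdorff_measure s (\<Union>((\<inter>) ?Z ` \<B>')) = 0"
    using \<B>'(1,2) r(2) by (intro hausdorff_null_countable_Union[OF s0]) (auto simp: \<B>_def)
  ultimately show ?thesis by (rule hausdorff_null_mono[OF s0, rotated])
qed

lemma derivs_vanish_continuous: "derivs_vanish n f \<Longrightarrow> continuous_on UNIV f"
proof (cases n)
  case (Suc k)
  assume "derivs_vanish n f"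
  then obtain g where "\<And>x. (f has_derivative (\<lambda>h. \<Sum>b\<in>Basis. (h \<bullet> b) * g b x)) (at x)"
    using Suc by auto
  then show ?thesis using has_derivative_continuous by (blast intro: continuous_at_imp_continuous_on)
qed simp

lemma hausdorff_null_zeros:
  fixes f :: "'a::euclidean_space \<Rightarrow> real"
  assumes s: "real DIM('a) - 1 < s"
  shows "derivs_vanish n f \<Longrightarrow> f a \<noteq> 0 \<Longrightarrow> hausdorff_measure s {x. f x = 0} = 0"
proof (induction n arbitrary: f a)
  case (Suc n)
  have s0: "0 < s" using s of_nat_mono[OF DIM_ge_Suc0[where 'a='a], where 'a=real] by linarith
  obtain g where g: "\<And>b. b \<in> Basis \<Longrightarrow> derivs_vanish n (g b)"
    "\<And>x. (f has_derivative (\<lambda>h. \<Sum>b\<in>Basis. (h \<bullet> b) * g b x)) (at x)"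
    using Suc.prems(1) by auto
  show ?case
  proof (cases "\<exists>b\<in>Basis. \<exists>y. g b y \<noteq> 0")
    case True
    then obtain b y where b: "b \<in> Basis" "g b y \<noteq> 0" by blast
    have "hausdorff_measure s {x. f x = 0 \<and> g b x \<noteq> 0} = 0"
      using g by (intro hausdorff_null_regular_zeros[OF s _ _ b(1)]) (auto intro: derivs_vanish_continuous)
    moreover have "hausdorff_measure s {x. g b x = 0} = 0"
      using Suc.IH[OF g(1)[OF b(1)] b(2)] .
    ultimately have "hausdorff_measure s (\<Union>{{x. f x = 0 \<and> g b x \<noteq> 0}, {x. g b x = 0}}) = 0"
      by (intro hausdorff_null_countable_Union[OF s0]) auto
    then show ?thesis by (rule hausdorff_null_mono[OF s0]) auto
  next
    \<comment> \<open>Now \<open>f\<close> is the nonzero constant \<open>f a\<close>, and its zero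
      set is the empty union.\<close>
    case False
    then have "(f has_derivative (\<lambda>h. 0)) (at x)" for x using g(2)[of x] by simp
    then have "f x = f a" for x
      using has_derivative_zero_unique[of UNIV f] by auto
    then have "{x. f x = 0} = \<Union>{}" using Suc.prems(2) by (metis (mono_tags, lifting) Collect_empty_eq Union_empty)
    then show ?thesis using hausdorff_null_countable_Union[OF s0, of "{}"] by (metis countable_empty empty_iff)
  qed
qed simp

lemma lower_dimensional_real_polynomial_zeros:
  fixes f :: "'a::euclidean_space \<Rightarrow> real"
  assumes "real_polynomial_function f" "f a \<noteq> 0"
  shows "lower_dimensional {x. f x = 0}"
proof -
  \<comment> \<open>An exponent strictly between \<open>DIM('a) - 1\<close> and
    \<open>DIM('a)\<close>: large enough for the zeros to be null, small enough to bound their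
    dimension strictly.\<close>
  define s where "s = real DIM('a) - 1 / 2"
  have s: "real DIM('a) - 1 < s" "s < real DIM('a)" by (auto simp: s_def)
  have s0: "0 < s" using s(1) of_nat_mono[OF DIM_ge_Suc0[where 'a='a], where 'a=real] by linarith
  have "hausdorff_measure s {x. f x = 0} = 0"
    using real_polynomial_function_imp_derivs_vanish[OF assms(1)] hausdorff_null_zeros[OF s(1)] assms(2)
    by blast
  then have "hausdorff_dim {x. f x = 0} \<le> ennreal s"
    unfolding hausdorff_dim_def using s0 by (intro INF_lower) auto
  also have "\<dots> < of_nat DIM('a)"
    using s(2) s0 by (simp add: ennreal_of_nat_eq_real_of_nat ennreal_less_iff)
  finally show ?thesis by (simp add: lower_dimensional_def)
qed

section \<open>Zero sets of complex-valued polynomials\<close>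

lemma lower_dimensional_mono: "lower_dimensional T \<Longrightarrow> S \<subseteq> T \<Longrightarrow> lower_dimensional S"
  unfolding lower_dimensional_def hausdorff_dim_def INF_less_iff
  using hausdorff_null_mono by blast

text \<open>Polynomial in the real coordinates, not necessarily holomorphic: the estimate of zero
  sets uses real derivatives only.\<close>

definition complex_polynomial :: "('a::euclidean_space \<Rightarrow> complex) \<Rightarrow> bool" where
  "complex_polynomial f \<longleftrightarrow>
     real_polynomial_function (\<lambda>x. Re (f x)) \<and> real_polynomial_function (\<lambda>x. Im (f x))"

lemma complex_polynomial_const: "complex_polynomial (\<lambda>x. c)"
  by (simp add: complex_polynomial_def real_polynomial_function.intros(2))

lemma complex_polynomial_nth: "complex_polynomial (\<lambda>x::complex^'e. x $ k)"
  unfolding complex_polynomial_def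
  by (intro conjI real_polynomial_function.intros(1) bounded_linear_compose[OF bounded_linear_Re]
      bounded_linear_compose[OF bounded_linear_Im] bounded_linear_vec_nth)

lemma complex_polynomial_add:
  "complex_polynomial f \<Longrightarrow> complex_polynomial g \<Longrightarrow> complex_polynomial (\<lambda>x. f x + g x)"
  by (simp add: complex_polynomial_def real_polynomial_function.intros(3))

lemma complex_polynomial_mult:
  "complex_polynomial f \<Longrightarrow> complex_polynomial g \<Longrightarrow> complex_polynomial (\<lambda>x. f x * g x)"
  unfolding complex_polynomial_def times_complex.sel
  by (intro conjI real_polynomial_function_diff real_polynomial_function.intros(3) real_polynomial_function.intros(4)) auto

lemma complex_polynomial_diff:
  "complex_polynomial f \<Longrightarrow> complex_polynomial g \<Longrightarrow> complex_polynomial (\<lambda>x. f x - g x)"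
  by (simp add: complex_polynomial_def real_polynomial_function_diff)

lemma complex_polynomial_sum:
  "(\<And>i. i \<in> I \<Longrightarrow> complex_polynomial (f i)) \<Longrightarrow> complex_polynomial (\<lambda>x. \<Sum>i\<in>I. f i x)"
  by (induction I rule: infinite_finite_induct) (auto intro: complex_polynomial_const complex_polynomial_add)

lemma complex_polynomial_prod:
  "(\<And>i. i \<in> I \<Longrightarrow> complex_polynomial (f i)) \<Longrightarrow> complex_polynomial (\<lambda>x. \<Prod>i\<in>I. f i x)"
  by (induction I rule: infinite_finite_induct) (auto intro: complex_polynomial_const complex_polynomial_mult)

lemma complex_polynomial_det:
  fixes A :: "'a::euclidean_space \<Rightarrow> complex^'n^'n"
  assumes "\<And>i j. complex_polynomial (\<lambda>x. A x $ i $ j)"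
  shows "complex_polynomial (\<lambda>x. det (A x))"
  unfolding det_def
  by (intro complex_polynomial_sum complex_polynomial_mult complex_polynomial_prod complex_polynomial_const assms)

lemma complex_polynomial_continuous:
  assumes "complex_polynomial f"
  shows "continuous_on S f"
proof -
  have "continuous_on S (\<lambda>x. complex_of_real (Re (f x)) + \<i> * complex_of_real (Im (f x)))"
    using assms unfolding complex_polynomial_def real_polynomial_function_eq
    by (intro continuous_on_add continuous_on_mult continuous_on_const continuous_on_of_real
        continuous_on_polymonial_function) auto
  then show ?thesis by (simp flip: complex_eq)
qed

text \<open>Real codimension one is enough, so the zero set may be enlarged to that of the real or
  of the imaginary part, whichever does not vanish at \<open>a\<close>.\<close>

lemma lower_dimensional_complex_polynomial_zeros:
  assumes "complex_polynomial f" "f a \<noteq> 0"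
  shows "lower_dimensional {x. f x = 0}"
proof (cases "Re (f a) = 0")
  case True
  then have "Im (f a) \<noteq> 0" using assms(2) by (simp add: complex_eq_iff)
  then have "lower_dimensional {x. Im (f x) = 0}"
    using assms(1) unfolding complex_polynomial_def
    by (intro lower_dimensional_real_polynomial_zeros[of _ a]) auto
  then show ?thesis by (rule lower_dimensional_mono) auto
next
  case False
  then have "lower_dimensional {x. Re (f x) = 0}"
    using assms(1) unfolding complex_polynomial_def
    by (intro lower_dimensional_real_polynomial_zeros[of _ a]) auto
  then show ?thesis by (rule lower_dimensional_mono) auto
qed


section \<open>Generic kernels\<close>

text \<open>
  The determinant of this matrix is, up to sign, the minor of \<open>M\<close> with rows \<open>\<rho> ` S\<close> and columns \<open>S\<close>.
\<close>

definition completed :: "'e set \<Rightarrow> ('e \<Rightarrow> 'r) \<Rightarrow> 'a::zero_neq_one^'e^'r \<Rightarrow> 'a^'e^'e" where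
  "completed S \<rho> M = (\<chi> k l. if k \<in> S then M $ \<rho> k $ l else if l = k then 1 else 0)"

lemma completed_mult_vec:
  fixes M :: "'a::field^'e::finite^'r"
  shows "(completed S \<rho> M *v v) $ k = (if k \<in> S then (M *v v) $ \<rho> k else v $ k)"
proof -
  have "(\<Sum>j\<in>UNIV. (if j = k then 1 else 0) * v $ j) = (\<Sum>j\<in>UNIV. if j = k then v $ j else 0)"
    by (rule sum.cong) auto
  then show ?thesis by (simp add: completed_def matrix_vector_mult_def)
qed

lemma det_nz_iff_kernel:
  fixes A :: "'a::field^'n^'n"
  shows "det A \<noteq> 0 \<longleftrightarrow> (\<forall>v. A *v v = 0 \<longrightarrow> v = 0)"
  by (metis invertible_det_nz invertible_left_inverse matrix_left_invertible_ker)

text \<open>Steinitz exchange: row \<open>q\<close> of \<open>M\<close> is a combination of the rows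
  of the invertible matrix \<open>?A\<close>, with coefficients \<open>(M ** A') $ q $ l\<close>.
  Evaluation at \<open>v\<close> exhibits a nonzero coefficient at some \<open>l\<close> outside
  \<open>S\<close>, and the unit row at \<open>l\<close> can be replaced by row
  \<open>q\<close>.\<close>

lemma completed_exchange_row:
  fixes M :: "'a::field^'e::finite^'r::finite"
  assumes det: "det (completed S \<rho> M) \<noteq> 0"
    and v: "\<And>k. k \<in> S \<Longrightarrow> (M *v v) $ \<rho> k = 0" and q: "(M *v v) $ q \<noteq> 0"
  obtains l where "l \<notin> S" "det (completed (insert l S) (\<rho>(l := q)) M) \<noteq> 0"
proof -
  let ?A = "completed S \<rho> M"
  obtain A' where A': "A' ** ?A = mat 1" using det by (metis invertible_det_nz invertible_left_inverse)
  have row: "(M *v u) $ q = (\<Sum>l\<in>UNIV. (M ** A') $ q $ l * (?A *v u) $ l)" for u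
  proof -
    have "M *v u = (M ** A') *v (?A *v u)"
      by (simp add: matrix_vector_mul_assoc A' flip: matrix_mul_assoc)
    then show ?thesis by (simp add: matrix_vector_mult_def)
  qed
  then obtain l where l: "(M ** A') $ q $ l \<noteq> 0" "(?A *v v) $ l \<noteq> 0"
    using q[unfolded row] by (metis (no_types, lifting) mult_zero_left mult_zero_right sum.neutral)
  then have "l \<notin> S" using v by (auto simp: completed_mult_vec)
  have "u = 0" if u: "completed (insert l S) (\<rho>(l := q)) M *v u = 0" for u
  proof -
    have u_nth: "(if k \<in> insert l S then (M *v u) $ (\<rho>(l := q)) k else u $ k) = 0" for k
      unfolding completed_mult_vec[symmetric] u by simp
    have z: "(?A *v u) $ k = 0" if "k \<noteq> l" for k
      using u_nth[of k] that by (auto simp: completed_mult_vec split: if_splits)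
    have "(M *v u) $ q = (M ** A') $ q $ l * (?A *v u) $ l"
      unfolding row by (simp add: sum.remove[of UNIV l] z)
    then have "0 = (M ** A') $ q $ l * (?A *v u) $ l" using u_nth[of l] by simp
    then have "?A *v u = 0" using l(1) z unfolding vec_eq_iff by (metis mult_eq_0_iff zero_index)
    then show ?thesis using det unfolding det_nz_iff_kernel by blast
  qed
  then show thesis using that \<open>l \<notin> S\<close> unfolding det_nz_iff_kernel by blast
qed

text \<open>Steinitz exchange again: now the unit row of \<open>e\<close> is expanded in the rows of
  \<open>?A\<close> and replaces the unit row of some \<open>l\<close> outside \<open>S\<close>. The
  row \<open>\<rho> e\<close> of \<open>M\<close> moves from position \<open>e\<close> to position
  \<open>l\<close>, so the size of the minor is unchanged.\<close>

lemma completed_exchange_column: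
  fixes M :: "'a::field^'e::finite^'r::finite"
  assumes det: "det (completed S \<rho> M) \<noteq> 0"
    and v: "\<And>k. k \<in> S \<Longrightarrow> (M *v v) $ \<rho> k = 0" and e: "e \<in> S" "v $ e \<noteq> 0"
  obtains l where "l \<notin> S" "det (completed (insert l (S - {e})) (\<rho>(l := \<rho> e)) M) \<noteq> 0"
proof -
  let ?A = "completed S \<rho> M"
  obtain A' where A': "A' ** ?A = mat 1" using det by (metis invertible_det_nz invertible_left_inverse)
  have nth_e: "u $ e = (\<Sum>l\<in>UNIV. A' $ e $ l * (?A *v u) $ l)" for u
  proof -
    have "u = A' *v (?A *v u)" by (simp add: matrix_vector_mul_assoc A')
    then have "u $ e = (A' *v (?A *v u)) $ e" by simp
    then show ?thesis by (simp add: matrix_vector_mult_def)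
  qed
  then obtain l where l: "A' $ e $ l \<noteq> 0" "(?A *v v) $ l \<noteq> 0"
    using e(2)[unfolded nth_e[of v]] by (metis (no_types, lifting) mult_zero_left mult_zero_right sum.neutral)
  then have "l \<notin> S" using v by (auto simp: completed_mult_vec)
  have "u = 0" if u: "completed (insert l (S - {e})) (\<rho>(l := \<rho> e)) M *v u = 0" for u
  proof -
    have u_nth: "(if k \<in> insert l (S - {e}) then (M *v u) $ (\<rho>(l := \<rho> e)) k else u $ k) = 0" for k
      unfolding completed_mult_vec[symmetric] u by simp
    \<comment> \<open>For \<open>k = e\<close> the entry belongs to row \<open>\<rho> e\<close> of
      \<open>M\<close>, which the new matrix carries at position \<open>l\<close>.\<close>
    have z: "(?A *v u) $ k = 0" if "k \<noteq> l" for k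
      using u_nth[of k] u_nth[of l] that by (auto simp: completed_mult_vec split: if_splits)
    have "u $ e = 0" using u_nth[of e] e(1) \<open>l \<notin> S\<close> by (auto split: if_splits)
    then have "0 = A' $ e $ l * (?A *v u) $ l"
      unfolding nth_e[of u] by (simp add: sum.remove[of UNIV l] z)
    then have "?A *v u = 0" using l(1) z unfolding vec_eq_iff by (metis mult_eq_0_iff zero_index)
    then show ?thesis using det unfolding det_nz_iff_kernel by blast
  qed
  then show thesis using that \<open>l \<notin> S\<close> unfolding det_nz_iff_kernel by blast
qed

text \<open>
  A nonvanishing minor of maximal size: its rows determine the kernel wherever it does not vanish,
  and if it cannot be chosen to avoid the column \<open>e\<close>, then this column is independent of the others.
\<close>

lemma generic_kernel:
  fixes M :: "'x \<Rightarrow> complex^'e::finite^'r::finite" and e :: 'e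
  assumes "x \<in> X"
  shows "\<exists>S \<rho>. (\<exists>x\<in>X. det (completed S \<rho> (M x)) \<noteq> 0) \<and>
    (\<forall>x\<in>X. det (completed S \<rho> (M x)) \<noteq> 0 \<longrightarrow>
       (\<forall>v. (\<forall>k\<in>S. (M x *v v) $ \<rho> k = 0) \<longrightarrow> M x *v v = 0)) \<and>
    (e \<notin> S \<or> (\<forall>x\<in>X. det (completed S \<rho> (M x)) \<noteq> 0 \<longrightarrow> ker_perp (M x) e))"
proof -
  define P where "P = (\<lambda>n S \<rho>. card S = n \<and> (\<exists>x\<in>X. det (completed S \<rho> (M x)) \<noteq> 0))"
  \<comment> \<open>The empty minor equals 1, so a maximal size exists.\<close>
  have "completed {} (\<lambda>_. undefined) (M x) = mat 1"
    by (auto simp: completed_def mat_def vec_eq_iff)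
  then have "det (completed {} (\<lambda>_. undefined) (M x)) \<noteq> 0" by simp
  then have "P 0 {} (\<lambda>_. undefined)" using assms unfolding P_def by (intro conjI bexI) auto
  then have ex: "\<exists>S \<rho>. P 0 S \<rho>" by blast
  have bound: "\<exists>S \<rho>. P n S \<rho> \<Longrightarrow> n \<le> CARD('e)" for n by (auto simp: P_def card_mono)
  \<comment> \<open>The maximum is taken over all points of \<open>X\<close>, so at no point is
    there a nonvanishing minor of size \<open>n + 1\<close>.\<close>
  define n where "n = (GREATEST n. \<exists>S \<rho>. P n S \<rho>)"
  have n: "\<exists>S \<rho>. P n S \<rho>"
    unfolding n_def by (rule GreatestI_nat[where P = "\<lambda>n. \<exists>S \<rho>. P n S \<rho>", OF ex bound])
  have n_max: "\<not> P (Suc n) S \<rho>" for S \<rho>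
    using Greatest_le_nat[of "\<lambda>n. \<exists>S \<rho>. P n S \<rho>" "Suc n" "CARD('e)"] bound
    unfolding n_def[symmetric] by force
  obtain S \<rho> where S: "P n S \<rho>" "e \<notin> S \<or> (\<forall>S \<rho>. P n S \<rho> \<longrightarrow> e \<in> S)" using n by blast
  obtain x0 where x0: "x0 \<in> X" "det (completed S \<rho> (M x0)) \<noteq> 0" using S(1) by (auto simp: P_def)
  \<comment> \<open>A vector killed by the selected rows but not by some row \<open>q\<close> would
    allow the minor to be enlarged by \<open>q\<close>.\<close>
  have ker: "M x *v v = 0"
    if x: "x \<in> X" and det: "det (completed S \<rho> (M x)) \<noteq> 0"
      and v: "\<And>k. k \<in> S \<Longrightarrow> (M x *v v) $ \<rho> k = 0" for x v
  proof (rule ccontr)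
    assume "M x *v v \<noteq> 0"
    then obtain q where q: "(M x *v v) $ q \<noteq> 0" by (auto simp: vec_eq_iff)
    obtain l where "l \<notin> S" "det (completed (insert l S) (\<rho>(l := q)) (M x)) \<noteq> 0"
      by (rule completed_exchange_row[OF det v q])
    then have "P (Suc n) (insert l S) (\<rho>(l := q))"
      using S(1) x unfolding P_def by (metis card_insert_disjoint finite)
    then show False using n_max by blast
  qed
  \<comment> \<open>A kernel vector with nonzero entry at \<open>e\<close> would allow
    \<open>e\<close> to be exchanged for some \<open>l\<close>, giving a maximal minor that avoids
    \<open>e\<close>, against the choice of \<open>S\<close>.\<close>
  have perp: "ker_perp (M x) e" if e: "e \<in> S" and x: "x \<in> X" "det (completed S \<rho> (M x)) \<noteq> 0" for x
    unfolding ker_perp_def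
  proof (intro allI impI, rule ccontr)
    fix v assume v: "M x *v v = 0" "v $ e \<noteq> 0"
    obtain l where l: "l \<notin> S" "det (completed (insert l (S - {e})) (\<rho>(l := \<rho> e)) (M x)) \<noteq> 0"
      by (rule completed_exchange_column[OF x(2) _ e v(2)]) (simp add: v(1))
    have "card (insert l (S - {e})) = card S"
      using l(1) card_Suc_Diff1[OF finite e] by simp
    then have "P n (insert l (S - {e})) (\<rho>(l := \<rho> e))" using S(1) x(1) l(2) unfolding P_def by metis
    then have "e \<in> insert l (S - {e})" using S(2) e by blast
    then show False using l(1) e by auto
  qed
  show ?thesis using x0 ker perp by blast
qed


section \<open>The transfer matrix\<close>

lemma matrix_sub_ldistrib: "A ** (B - C) = A ** B - A ** (C :: 'a::ring_1^'p^'n)"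
  by (simp add: matrix_matrix_mult_def vec_eq_iff right_diff_distrib sum_subtractf)

lemma matrix_sub_rdistrib: "(A - B) ** C = A ** C - B ** (C :: 'a::ring_1^'p^'n)"
  by (simp add: matrix_matrix_mult_def vec_eq_iff left_diff_distrib sum_subtractf)

section \<open>Vectorization and parametrization\<close>

lemma kronecker_mult_vectorize:
  "kronecker (transpose Y) X *v vectorize Z = vectorize (X ** Z ** Y)"
proof -
  have "(\<Sum>v\<in>UNIV. transpose Y $ a $ fst v * X $ b $ snd v * Z $ snd v $ fst v)
      = (\<Sum>k\<in>UNIV. (\<Sum>l\<in>UNIV. X $ b $ l * Z $ l $ k) * Y $ k $ a)" for a b
    unfolding UNIV_Times_UNIV[symmetric] sum.cartesian_product'
    by (simp add: transpose_def sum_distrib_left sum_distrib_right mult_ac)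
  then show ?thesis
    by (simp add: kronecker_def vectorize_def matrix_vector_mult_def matrix_matrix_mult_def vec_eq_iff)
qed

lemma vectorize_eq_iff: "vectorize A = vectorize B \<longleftrightarrow> A = B"
  by (auto simp: vectorize_def vec_eq_iff)

lemma vectorize_diff: "vectorize (A - B) = vectorize A - vectorize B"
  by (simp add: vectorize_def vec_eq_iff)

lemma vectorize_eq_0_iff: "vectorize A = 0 \<longleftrightarrow> A = 0"
  by (auto simp: vectorize_def vec_eq_iff)

lemma param_nth:
  assumes "inj edge" "edge k = (j, i)"
  shows "param edge x $ i $ j = x $ k"
proof -
  have "edge k' = (j, i) \<longleftrightarrow> k' = k" for k' using assms by (metis injD)
  then show ?thesis by (simp add: param_def)
qed

lemma param_diff: "param edge (x - y) = param edge x - param edge y"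
  by (simp add: param_def vec_eq_iff flip: sum_subtractf) (auto intro!: sum.cong)

lemma param_zero [simp]: "param edge 0 = 0"
  by (simp add: param_def vec_eq_iff cong: if_cong)

lemma edge_selection_mult: "edge_selection edge *v x = vectorize (param edge x)"
proof -
  have "(\<Sum>k\<in>UNIV. (\<Sum>k'\<in>UNIV. if edge k' = (j, i) then axis k 1 $ k' else 0) * x $ k)
      = (\<Sum>k\<in>UNIV. if edge k = (j, i) then x $ k else 0)" for i j
  proof (rule sum.cong[OF refl])
    fix k
    have "(\<Sum>k'\<in>UNIV. if edge k' = (j, i) then axis k 1 $ k' else 0)
        = (\<Sum>k'\<in>UNIV. if k' = k then (if edge k = (j, i) then 1 else 0) else (0::complex))"
      by (rule sum.cong) (auto simp: axis_def)
    then show "(\<Sum>k'\<in>UNIV. if edge k' = (j, i) then axis k 1 $ k' else 0) * x $ k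
        = (if edge k = (j, i) then x $ k else 0)" by simp
  qed
  then show ?thesis
    by (simp add: edge_selection_def vectorize_def param_def matrix_vector_mult_def vec_eq_iff)
qed

lemma consistent_param:
  assumes "bij_betw edge UNIV E"
  shows "consistent E (param edge x)"
proof -
  have "edge k \<noteq> (j, i)" if "(j, i) \<notin> E" for i j k
    using assms that by (metis bij_betw_imp_surj_on rangeI)
  then show ?thesis by (simp add: consistent_def param_def)
qed

lemma consistent_imp_param:
  assumes edge: "bij_betw edge UNIV E" and A: "consistent E A"
  shows "A = param edge (\<chi> k. A $ snd (edge k) $ fst (edge k))" (is "_ = param edge ?x")
proof -
  have "A $ i $ j = param edge ?x $ i $ j" for i j
  proof (cases "(j, i) \<in> E")
    case True
    then obtain k where k: "edge k = (j, i)" using edge by (metis bij_betw_imp_surj_on imageE)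
    have "inj edge" using edge by (rule bij_betw_imp_inj_on)
    show ?thesis by (simp add: param_nth[OF \<open>inj edge\<close> k] k)
  next
    case False
    then show ?thesis using A consistent_param[OF edge, of ?x] unfolding consistent_def by simp
  qed
  then show ?thesis unfolding vec_eq_iff by blast
qed

section \<open>Inverses, adjugates and polynomial entries\<close>

lemma matrix_inv_inverse:
  assumes "det A \<noteq> 0"
  shows "A ** matrix_inv A = mat 1" "matrix_inv A ** A = mat (1::'a::field)"
proof -
  have "\<exists>A'. A ** A' = mat 1 \<and> A' ** A = mat 1" using assms by (simp add: invertible_det_nz[symmetric] invertible_def)
  from someI_ex[OF this] show "A ** matrix_inv A = mat 1" "matrix_inv A ** A = mat 1"
    by (auto simp: matrix_inv_def)
qed

text \<open>The resolvent identity. Being exact, it yields differences of transfer matrices without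
  a remainder term.\<close>

lemma matrix_inv_diff:
  assumes "det A \<noteq> 0" "det B \<noteq> 0"
  shows "matrix_inv A - matrix_inv B = matrix_inv A ** (B - A) ** matrix_inv (B::'a::field^'n^'n)"
  by (simp add: matrix_sub_ldistrib matrix_sub_rdistrib matrix_inv_inverse assms flip: matrix_mul_assoc)

text \<open>The classical adjugate in the form given by Cramer's rule: as determinants, its entries
  are polynomial in those of \<open>A\<close>.\<close>

definition adjugate :: "'a::field^'n::finite^'n \<Rightarrow> 'a^'n^'n" where
  "adjugate A = (\<chi> k l. det (\<chi> i j. if j = k then (if i = l then 1 else 0) else A $ i $ j))"

lemma matrix_inv_eq_adjugate:
  assumes "det A \<noteq> 0"
  shows "matrix_inv A $ k $ l = adjugate A $ k $ l / det A"
proof -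
  have "A *v column l (matrix_inv A) = (\<chi> i. if i = l then 1 else 0)"
    using matrix_inv_inverse(1)[OF assms]
    by (auto simp: vec_eq_iff matrix_vector_mult_def matrix_matrix_mult_def column_def mat_def)
  then have "column l (matrix_inv A) $ k = adjugate A $ k $ l / det A"
    unfolding cramer[OF assms] by (simp add: adjugate_def cong: if_cong)
  then show ?thesis by (simp add: column_def)
qed

lemma complex_polynomial_param_entry:
  "complex_polynomial (\<lambda>x. (mat 1 - param edge x) $ i $ j)"
proof -
  have "complex_polynomial (\<lambda>x. if edge k = (j, i) then x $ k else 0)" for k
    by (cases "edge k = (j, i)") (auto intro: complex_polynomial_nth complex_polynomial_const)
  then show ?thesis
    unfolding param_def
    by (simp, intro complex_polynomial_diff complex_polynomial_const complex_polynomial_sum)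
qed

lemma complex_polynomial_det_param: "complex_polynomial (\<lambda>x. det (mat 1 - param edge x))"
  by (intro complex_polynomial_det complex_polynomial_param_entry)

lemma complex_polynomial_adjugate_param:
  "complex_polynomial (\<lambda>x. adjugate (mat 1 - param edge x) $ k $ l)"
proof -
  have "complex_polynomial (\<lambda>x. if j = k then (if i = l then 1 else 0) else (mat 1 - param edge x) $ i $ j)" for i j
    using complex_polynomial_const complex_polynomial_param_entry by (cases "j = k") auto
  then show ?thesis
    unfolding adjugate_def by (simp, intro complex_polynomial_det) simp
qed

text \<open>
  \<^term>\<open>K_matrix\<close> multiplied by the square of the determinant, so that its entries are polynomial.
\<close>

definition polynomial_K ::
    "('e::finite \<Rightarrow> 'n::finite \<times> 'n) \<Rightarrow> complex^'b^'n \<Rightarrow> complex^'n^'c \<Rightarrow> complex^'e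
      \<Rightarrow> complex^'e^('b \<times> 'c)" where
  "polynomial_K edge B C x =
     kronecker (transpose B ** transpose (adjugate (mat 1 - param edge x)))
               (C ** adjugate (mat 1 - param edge x)) ** edge_selection edge"

lemma complex_polynomial_polynomial_K: "complex_polynomial (\<lambda>x. polynomial_K edge B C x $ p $ k)"
  unfolding polynomial_K_def kronecker_def matrix_matrix_mult_def transpose_def
  by (simp, intro complex_polynomial_sum complex_polynomial_mult complex_polynomial_const
        complex_polynomial_adjugate_param)

lemma polynomial_K_eq:
  assumes "det (mat 1 - param edge x) \<noteq> 0"
  shows "polynomial_K edge B C x $ p $ k = (det (mat 1 - param edge x))\<^sup>2 * K_matrix edge B C x $ p $ k"
proof -
  let ?d = "det (mat 1 - param edge x)"
  have "adjugate (mat 1 - param edge x) = (\<chi> i j. ?d * transfer_matrix edge x $ i $ j)"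
    using assms by (simp add: vec_eq_iff transfer_matrix_def matrix_inv_eq_adjugate)
  then show ?thesis
    unfolding polynomial_K_def K_matrix_def kronecker_def matrix_matrix_mult_def transpose_def
    by (simp add: sum_distrib_left sum_distrib_right power2_eq_square mult_ac)
qed

text \<open>Scaling the selected rows by a nonzero number does not change the kernel of the
  completed matrix, so the power of the determinant need not be computed.\<close>

lemma det_completed_K_iff:
  assumes "det (mat 1 - param edge x) \<noteq> 0"
  shows "det (completed S \<rho> (K_matrix edge B C x)) \<noteq> 0 \<longleftrightarrow> det (completed S \<rho> (polynomial_K edge B C x)) \<noteq> 0"
proof -
  have "(polynomial_K edge B C x *v v) $ p = (det (mat 1 - param edge x))\<^sup>2 * (K_matrix edge B C x *v v) $ p" for p v
    by (simp add: matrix_vector_mult_def polynomial_K_eq[OF assms] sum_distrib_left mult_ac)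
  then show ?thesis
    unfolding det_nz_iff_kernel using assms by (auto simp: vec_eq_iff completed_mult_vec)
qed

section \<open>The kernel of \<open>K_matrix\<close> in terms of consistent matrices\<close>

lemma K_matrix_mult:
  "K_matrix edge B C x *v \<delta>
     = vectorize (C ** transfer_matrix edge x ** param edge \<delta> ** transfer_matrix edge x ** B)"
proof -
  have "K_matrix edge B C x *v \<delta> = kronecker (transpose (transfer_matrix edge x ** B))
      (C ** transfer_matrix edge x) *v vectorize (param edge \<delta>)"
    by (simp add: K_matrix_def matrix_transpose_mul edge_selection_mult flip: matrix_vector_mul_assoc)
  then show ?thesis by (simp add: kronecker_mult_vectorize matrix_mul_assoc)
qed

text \<open>The consistent matrices are exactly the \<open>param edge \<delta>\<close>, with entry
  \<open>\<delta> $ e\<close> in row \<open>i\<close> and column \<open>j\<close>; by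
  \<open>K_matrix_mult\<close> both sides then speak of the same kernel.\<close>

lemma ker_perp_K_iff:
  assumes edge: "bij_betw edge UNIV E" and e: "edge e = (j, i)"
  shows "ker_perp (K_matrix edge B C x) e \<longleftrightarrow>
    (\<forall>\<Delta>. consistent E \<Delta> \<longrightarrow>
       C ** matrix_inv (mat 1 - param edge x) ** \<Delta> ** matrix_inv (mat 1 - param edge x) ** B = 0
       \<longrightarrow> \<Delta> $ i $ j = 0)" (is "_ \<longleftrightarrow> (\<forall>\<Delta>. _ \<longrightarrow> ?L \<Delta> = 0 \<longrightarrow> _)")
proof -
  have inj: "inj edge" using edge by (rule bij_betw_imp_inj_on)
  have "K_matrix edge B C x *v \<delta> = 0 \<longleftrightarrow> ?L (param edge \<delta>) = 0" for \<delta>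
    by (simp add: K_matrix_mult vectorize_eq_0_iff transfer_matrix_def)
  then have "ker_perp (K_matrix edge B C x) e \<longleftrightarrow>
      (\<forall>\<delta>. ?L (param edge \<delta>) = 0 \<longrightarrow> param edge \<delta> $ i $ j = 0)"
    by (simp add: ker_perp_def param_nth[OF inj e])
  also have "\<dots> \<longleftrightarrow> (\<forall>\<Delta>. consistent E \<Delta> \<longrightarrow> ?L \<Delta> = 0 \<longrightarrow> \<Delta> $ i $ j = 0)"
  proof (intro iffI allI impI)
    fix \<Delta> assume *: "\<forall>\<delta>. ?L (param edge \<delta>) = 0 \<longrightarrow> param edge \<delta> $ i $ j = 0" "consistent E \<Delta>" "?L \<Delta> = 0"
    obtain \<delta> where "\<Delta> = param edge \<delta>" using consistent_imp_param[OF edge *(2)] by blast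
    then show "\<Delta> $ i $ j = 0" using * by blast
  qed (use consistent_param[OF edge] in blast)
  finally show ?thesis .
qed

section \<open>The transfer map and its derivative\<close>

definition transfer_vector ::
    "('e::finite \<Rightarrow> 'n::finite \<times> 'n) \<Rightarrow> complex^'b^'n \<Rightarrow> complex^'n^'c \<Rightarrow> complex^'e
      \<Rightarrow> complex^('b \<times> 'c)" where
  "transfer_vector edge B C x = vectorize (C ** transfer_matrix edge x ** B)"

text \<open>By the resolvent identity the difference is exactly a matrix times \<open>y - x\<close>;
  this matrix is \<open>K_matrix\<close> with one of its two transfer matrices taken at
  \<open>y\<close>.\<close>

lemma transfer_vector_diff:
  assumes "det (mat 1 - param edge x) \<noteq> 0" "det (mat 1 - param edge y) \<noteq> 0"
  shows "transfer_vector edge B C y - transfer_vector edge B C x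
    = (kronecker (transpose B ** transpose (transfer_matrix edge x)) (C ** transfer_matrix edge y)
        ** edge_selection edge) *v (y - x)"
proof -
  have "transfer_matrix edge y - transfer_matrix edge x
      = transfer_matrix edge y ** param edge (y - x) ** transfer_matrix edge x"
    using matrix_inv_diff[OF assms(2,1)] by (simp add: transfer_matrix_def param_diff)
  then have "C ** transfer_matrix edge y ** B - C ** transfer_matrix edge x ** B
      = C ** transfer_matrix edge y ** param edge (y - x) ** (transfer_matrix edge x ** B)"
    by (simp add: matrix_mul_assoc flip: matrix_sub_ldistrib matrix_sub_rdistrib)
  then show ?thesis
    by (simp add: transfer_vector_def edge_selection_mult kronecker_mult_vectorize
        flip: matrix_vector_mul_assoc vectorize_diff matrix_transpose_mul)
qed

lemma continuous_on_transfer_matrix_entry: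
  "continuous_on {x. det (mat 1 - param edge x) \<noteq> 0} (\<lambda>x. transfer_matrix edge x $ i $ j)"
proof -
  have "continuous_on {x. det (mat 1 - param edge x) \<noteq> 0}
      (\<lambda>x. adjugate (mat 1 - param edge x) $ i $ j / det (mat 1 - param edge x))"
    by (intro continuous_on_divide complex_polynomial_continuous complex_polynomial_adjugate_param
        complex_polynomial_det_param) auto
  then show ?thesis
    by (rule continuous_on_eq) (simp add: transfer_matrix_def matrix_inv_eq_adjugate)
qed

lemma open_det_param: "open {x. det (mat 1 - param edge x) \<noteq> 0}"
  using complex_polynomial_continuous[OF complex_polynomial_det_param, of UNIV edge]
  by (simp add: open_Collect_neq)

lemma continuous_on_K_entry:
  "continuous_on {x. det (mat 1 - param edge x) \<noteq> 0} (\<lambda>x. K_matrix edge B C x $ p $ k)"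
  unfolding K_matrix_def kronecker_def matrix_matrix_mult_def transpose_def
  by (simp, intro continuous_intros continuous_on_transfer_matrix_entry)

lemma norm_matrix_vector_mult_le:
  fixes A :: "complex^'n::finite^'m::finite"
  shows "norm (A *v v) \<le> (\<Sum>i\<in>UNIV. \<Sum>j\<in>UNIV. norm (A $ i $ j)) * norm v"
proof -
  have "norm (A *v v) \<le> (\<Sum>i\<in>UNIV. norm ((A *v v) $ i))"
    unfolding norm_vec_def by (rule L2_set_le_sum) simp
  also have "\<dots> \<le> (\<Sum>i\<in>UNIV. \<Sum>j\<in>UNIV. norm (A $ i $ j) * norm v)"
    unfolding matrix_vector_mult_def
    by (auto intro!: sum_mono order_trans[OF norm_sum] mult_left_mono Finite_Cartesian_Product.norm_nth_le simp: norm_mult)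
  finally show ?thesis by (simp add: sum_distrib_right)
qed

text \<open>Caratheodory's criterion: the remainder is \<open>(A y - A x) *v (y - x)\<close>, and
  its first factor tends to 0 by continuity of the entries.\<close>

lemma has_derivative_slope_matrix:
  fixes f :: "complex^'n::finite \<Rightarrow> complex^'m::finite"
  assumes U: "open U" "x \<in> U"
    and f: "\<And>y. y \<in> U \<Longrightarrow> f y - f x = A y *v (y - x)"
    and A: "\<And>i j. continuous_on U (\<lambda>y. A y $ i $ j)"
  shows "(f has_derivative (\<lambda>h. A x *v h)) (at x)"
proof -
  define \<phi> where "\<phi> = (\<lambda>y. \<Sum>i\<in>UNIV. \<Sum>j\<in>UNIV. norm ((A y - A x) $ i $ j))"
  have "continuous_on U \<phi>"
    unfolding \<phi>_def by (simp, intro continuous_intros A)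
  then have lim: "(\<phi> \<longlongrightarrow> 0) (at x)"
    using U by (auto simp: continuous_on_eq_continuous_at isCont_def \<phi>_def)
  have "((\<lambda>y. (f y - f x - A x *v (y - x)) /\<^sub>R norm (y - x)) \<longlongrightarrow> 0) (at x)"
  proof (rule Lim_null_comparison[OF _ lim])
    have "\<forall>\<^sub>F y in at x. y \<in> U" using U by (simp add: eventually_at_topological) blast
    then show "\<forall>\<^sub>F y in at x. norm ((f y - f x - A x *v (y - x)) /\<^sub>R norm (y - x)) \<le> \<phi> y"
    proof eventually_elim
      case (elim y)
      have "f y - f x - A x *v (y - x) = (A y - A x) *v (y - x)"
        by (simp add: f[OF elim] matrix_vector_mult_diff_rdistrib)
      then have "norm (f y - f x - A x *v (y - x)) \<le> \<phi> y * norm (y - x)"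
        using norm_matrix_vector_mult_le by (metis \<phi>_def)
      moreover have "0 \<le> \<phi> y" by (simp add: \<phi>_def sum_nonneg)
      ultimately show ?case
        by (cases "y = x") (simp_all add: divide_le_eq flip: divide_inverse_commute)
    qed
  qed
  then show ?thesis by (simp add: has_derivative_at_within)
qed

text \<open>At \<open>y = x\<close> the slope matrix of \<open>transfer_vector_diff\<close> is
  \<open>K_matrix edge B C x\<close>.\<close>

lemma transfer_vector_has_derivative:
  assumes "det (mat 1 - param edge x) \<noteq> 0"
  shows "(transfer_vector edge B C has_derivative (\<lambda>h. K_matrix edge B C x *v h)) (at x)"
  unfolding K_matrix_def
proof (rule has_derivative_slope_matrix[where
      A = "\<lambda>y. kronecker (transpose B ** transpose (transfer_matrix edge x)) (C ** transfer_matrix edge y)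
        ** edge_selection edge", OF open_det_param[of edge]])
  show "transfer_vector edge B C y - transfer_vector edge B C x
    = (kronecker (transpose B ** transpose (transfer_matrix edge x)) (C ** transfer_matrix edge y)
        ** edge_selection edge) *v (y - x)" if "y \<in> {x. det (mat 1 - param edge x) \<noteq> 0}" for y
    using transfer_vector_diff assms that by blast
  show "continuous_on {x. det (mat 1 - param edge x) \<noteq> 0}
     (\<lambda>y. (kronecker (transpose B ** transpose (transfer_matrix edge x)) (C ** transfer_matrix edge y)
        ** edge_selection edge) $ p $ k)" for p k
    unfolding kronecker_def matrix_matrix_mult_def
    by (simp, intro continuous_intros continuous_on_transfer_matrix_entry)
qed (use assms in simp)


section \<open>Fibres of maps of constant rank\<close>

text \<open>If \<open>F\<close> has Jacobian \<open>K x\<close>, then the Jacobian of this map is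
  \<open>completed S \<rho> (K x)\<close>.\<close>

definition partial_chart :: "'e set \<Rightarrow> ('e \<Rightarrow> 'r) \<Rightarrow> ('a^'e \<Rightarrow> 'a^'r) \<Rightarrow> 'a^'e \<Rightarrow> 'a^'e" where
  "partial_chart S \<rho> F x = (\<chi> k. if k \<in> S then F x $ \<rho> k else x $ k)"

text \<open>The inverse function theorem applies because the completed matrix is invertible. A chart
  direction \<open>w\<close> vanishing on \<open>S\<close> is pulled back to a vector killed by the
  selected rows of \<open>K\<close>, hence by all of \<open>K\<close>; this is where constancy of
  the rank enters.\<close>

lemma constant_rank_chart:
  fixes F :: "complex^'e::finite \<Rightarrow> complex^'r::finite" and K :: "complex^'e \<Rightarrow> complex^'e^'r"
  assumes U: "open U" "x0 \<in> U"
    and F: "\<And>x. x \<in> U \<Longrightarrow> (F has_derivative (\<lambda>h. K x *v h)) (at x)"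
    and K: "\<And>p k. continuous_on U (\<lambda>x. K x $ p $ k)"
    and det: "\<And>x. x \<in> U \<Longrightarrow> det (completed S \<rho> (K x)) \<noteq> 0"
    and ker: "\<And>x v. x \<in> U \<Longrightarrow> (\<And>k. k \<in> S \<Longrightarrow> (K x *v v) $ \<rho> k = 0) \<Longrightarrow> K x *v v = 0"
  obtains U' V \<Psi> \<Psi>' where "open U'" "U' \<subseteq> U" "x0 \<in> U'" "open V" "homeomorphism U' V (partial_chart S \<rho> F) \<Psi>"
    "\<And>y. y \<in> V \<Longrightarrow> (\<Psi> has_derivative \<Psi>' y) (at y)"
    "\<And>y w. y \<in> V \<Longrightarrow> (\<And>k. k \<in> S \<Longrightarrow> w $ k = 0) \<Longrightarrow> K (\<Psi> y) *v \<Psi>' y w = 0"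
proof -
  let ?A = "\<lambda>x. completed S \<rho> (K x)"
  let ?D = "\<lambda>x. Blinfun ((*v) (?A x))"
  have D: "blinfun_apply (?D x) = (*v) (?A x)" for x
    by (rule bounded_linear_Blinfun_apply) simp
  have der: "(partial_chart S \<rho> F has_derivative blinfun_apply (?D x)) (at x)" if "x \<in> U" for x
    unfolding D
  proof (subst has_derivative_componentwise_within, intro ballI)
    have nth: "((\<lambda>x. partial_chart S \<rho> F x $ k) has_derivative (\<lambda>h. (?A x *v h) $ k)) (at x)" for k
      using bounded_linear.has_derivative[OF bounded_linear_vec_nth F[OF that], of "\<rho> k"]
        bounded_linear_imp_has_derivative[OF bounded_linear_vec_nth, of k]
      by (cases "k \<in> S") (simp_all add: partial_chart_def completed_mult_vec)
    fix b :: "complex^'e" assume "b \<in> Basis"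
    then obtain k c where b: "b = axis k c" by (auto simp: Basis_vec_def)
    show "((\<lambda>x. partial_chart S \<rho> F x \<bullet> b) has_derivative (\<lambda>h. (?A x *v h) \<bullet> b)) (at x)"
      unfolding b inner_axis by (rule bounded_linear.has_derivative[OF bounded_linear_inner_left nth])
  qed
  have cont: "continuous_on U ?D"
  proof (rule continuous_on_blinfun_componentwise)
    fix v :: "complex^'e"
    have "continuous_on U (\<lambda>x. \<chi> k. if k \<in> S then (K x *v v) $ \<rho> k else v $ k)"
    proof (intro continuous_on_vec_lambda)
      fix k show "continuous_on U (\<lambda>x. if k \<in> S then (K x *v v) $ \<rho> k else v $ k)"
        by (cases "k \<in> S") (auto simp: matrix_vector_mult_def intro!: continuous_intros K)
    qed
    then show "continuous_on U (\<lambda>x. blinfun_apply (?D x) v)"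
      unfolding D by (rule continuous_on_eq) (simp add: vec_eq_iff completed_mult_vec)
  qed
  obtain A' where A': "A' ** ?A x0 = mat 1"
    using det[OF U(2)] by (metis invertible_det_nz invertible_left_inverse)
  have "Blinfun ((*v) A') o\<^sub>L ?D x0 = id_blinfun"
    by (rule blinfun_eqI) (simp add: D bounded_linear_Blinfun_apply matrix_vector_mul_assoc A')
  from inverse_function_theorem[OF U(1) der cont U(2) this]
  obtain U' V \<Psi> \<Psi>' where UV: "open U'" "U' \<subseteq> U" "x0 \<in> U'" "open V" "homeomorphism U' V (partial_chart S \<rho> F) \<Psi>"
    and \<Psi>: "\<And>y. y \<in> V \<Longrightarrow> (\<Psi> has_derivative \<Psi>' y) (at y)"
    "\<And>y. y \<in> V \<Longrightarrow> \<Psi>' y = inv (blinfun_apply (?D (\<Psi> y)))"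
    "\<And>y. y \<in> V \<Longrightarrow> bij (blinfun_apply (?D (\<Psi> y)))" by metis
  have "K (\<Psi> y) *v \<Psi>' y w = 0" if y: "y \<in> V" and w: "\<And>k. k \<in> S \<Longrightarrow> w $ k = 0" for y w
  proof (rule ker)
    show "\<Psi> y \<in> U" using UV y homeomorphism_image2 by blast
    have "?A (\<Psi> y) *v \<Psi>' y w = w"
      using \<Psi>(2,3)[OF y] unfolding D by (simp add: bij_is_surj surj_f_inv_f)
    then show "(K (\<Psi> y) *v \<Psi>' y w) $ \<rho> k = 0" if "k \<in> S" for k
      using w[OF that] completed_mult_vec[of S \<rho> "K (\<Psi> y)" "\<Psi>' y w" k] that by simp
  qed
  with UV \<Psi>(1) show thesis using that by blast
qed

text \<open>Two points of a fibre have charts that agree on \<open>S\<close>. Along the segment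
  between these charts the preimage moves in kernel directions, and there \<open>perp\<close> makes
  the derivative of the coordinate at \<open>e\<close> vanish.\<close>

lemma constant_rank_fibre_constant:
  fixes F :: "complex^'e::finite \<Rightarrow> complex^'r::finite" and K :: "complex^'e \<Rightarrow> complex^'e^'r"
  assumes U: "open U" "x0 \<in> U"
    and F: "\<And>x. x \<in> U \<Longrightarrow> (F has_derivative (\<lambda>h. K x *v h)) (at x)"
    and K: "\<And>p k. continuous_on U (\<lambda>x. K x $ p $ k)"
    and det: "\<And>x. x \<in> U \<Longrightarrow> det (completed S \<rho> (K x)) \<noteq> 0"
    and ker: "\<And>x v. x \<in> U \<Longrightarrow> (\<And>k. k \<in> S \<Longrightarrow> (K x *v v) $ \<rho> k = 0) \<Longrightarrow> K x *v v = 0"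
    and perp: "\<And>x. x \<in> U \<Longrightarrow> ker_perp (K x) e"
  obtains \<epsilon> where "0 < \<epsilon>" "\<And>x. norm (x - x0) < \<epsilon> \<Longrightarrow> F x = F x0 \<Longrightarrow> x $ e = x0 $ e"
proof -
  define \<Phi> where "\<Phi> = partial_chart S \<rho> F"
  obtain U' V \<Psi> \<Psi>' where UV: "open U'" "U' \<subseteq> U" "x0 \<in> U'" "open V" "homeomorphism U' V \<Phi> \<Psi>"
    and \<Psi>: "\<And>y. y \<in> V \<Longrightarrow> (\<Psi> has_derivative \<Psi>' y) (at y)"
    and null: "\<And>y w. y \<in> V \<Longrightarrow> (\<And>k. k \<in> S \<Longrightarrow> w $ k = 0) \<Longrightarrow> K (\<Psi> y) *v \<Psi>' y w = 0"
    using constant_rank_chart[OF U F K det ker] unfolding \<Phi>_def by blast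
  have inv: "\<Psi> (\<Phi> x) = x" "\<Phi> x \<in> V" if "x \<in> U'" for x
    using UV(5) that by (auto simp: homeomorphism_def)
  \<comment> \<open>A ball in the chart is convex, so the segment stays in \<open>V\<close>;
    \<open>\<epsilon>\<close> is then chosen so that the chart maps the ball around
    \<open>x0\<close> into this ball.\<close>
  obtain r where r: "0 < r" "ball (\<Phi> x0) r \<subseteq> V" using UV(4) inv(2)[OF UV(3)] open_contains_ball by blast
  have "open (U' \<inter> \<Phi> -` ball (\<Phi> x0) r)"
    using UV(1,5) by (intro continuous_open_preimage) (auto simp: homeomorphism_def)
  moreover have "x0 \<in> U' \<inter> \<Phi> -` ball (\<Phi> x0) r" using UV(3) r(1) by simp
  ultimately obtain \<epsilon> where \<epsilon>: "0 < \<epsilon>" "ball x0 \<epsilon> \<subseteq> U' \<inter> \<Phi> -` ball (\<Phi> x0) r"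
    using open_contains_ball by blast
  have "x $ e = x0 $ e" if x: "norm (x - x0) < \<epsilon>" "F x = F x0" for x
  proof -
    have "x \<in> ball x0 \<epsilon>" using x(1) by (simp add: dist_norm norm_minus_commute)
    then have xU: "x \<in> U'" "\<Phi> x \<in> ball (\<Phi> x0) r" using \<epsilon>(2) by auto
    define w where "w = \<Phi> x - \<Phi> x0"
    define h where "h = (\<lambda>t::real. \<Psi> (\<Phi> x0 + t *\<^sub>R w) $ e)"
    have w: "w $ k = 0" if "k \<in> S" for k using that x(2) by (simp add: w_def \<Phi>_def partial_chart_def)
    have V: "\<Phi> x0 + t *\<^sub>R w \<in> V" if "t \<in> {0..1}" for t
    proof -
      have "\<Phi> x0 + t *\<^sub>R w \<in> closed_segment (\<Phi> x0) (\<Phi> x)"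
        unfolding in_segment using that by (intro exI[of _ t]) (simp add: w_def algebra_simps)
      moreover have "closed_segment (\<Phi> x0) (\<Phi> x) \<subseteq> ball (\<Phi> x0) r"
        using xU(2) r(1) by (intro closed_segment_subset) auto
      ultimately show ?thesis using r(2) by blast
    qed
    have "(h has_derivative (\<lambda>_. 0)) (at t within {0..1})" if t: "t \<in> {0..1}" for t
    proof -
      let ?y = "\<Phi> x0 + t *\<^sub>R w"
      have "\<Psi> ?y \<in> U" using V[OF t] UV(2,5) homeomorphism_image2 by blast
      then have zero: "\<Psi>' ?y w $ e = 0" using perp null[OF V[OF t] w] by (auto simp: ker_perp_def)
      have "((\<lambda>t. \<Psi> (\<Phi> x0 + t *\<^sub>R w)) has_derivative (\<lambda>s. \<Psi>' ?y (s *\<^sub>R w))) (at t within {0..1})"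
        by (rule has_derivative_compose[of "\<lambda>t. \<Phi> x0 + t *\<^sub>R w" "\<lambda>s. s *\<^sub>R w", OF _ \<Psi>[OF V[OF t]]])
         (auto intro!: derivative_eq_intros)
      from bounded_linear.has_derivative[OF bounded_linear_vec_nth this, of e]
      have "(h has_derivative (\<lambda>s. \<Psi>' ?y (s *\<^sub>R w) $ e)) (at t within {0..1})" by (simp add: h_def)
      moreover have "\<Psi>' ?y (s *\<^sub>R w) = s *\<^sub>R \<Psi>' ?y w" for s
        using \<Psi>[OF V[OF t]] has_derivative_linear linear_scale by blast
      ultimately show ?thesis using zero by simp
    qed
    then have "h 1 = h 0" using has_derivative_zero_unique[of "{0..1}" h] by auto
    then show ?thesis using inv(1)[OF xU(1)] inv(1)[OF UV(3)] by (simp add: h_def w_def)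
  qed
  then show thesis using that \<epsilon>(1) by blast
qed

text \<open>Since \<open>e\<close> is outside \<open>S\<close>, it is a free chart coordinate:
  moving it changes \<open>x $ e\<close> itself, while the preimage moves in kernel directions and
  \<open>F\<close> stays constant.\<close>

lemma constant_rank_fibre_nonconstant:
  fixes F :: "complex^'e::finite \<Rightarrow> complex^'r::finite" and K :: "complex^'e \<Rightarrow> complex^'e^'r"
  assumes U: "open U" "x0 \<in> U"
    and F: "\<And>x. x \<in> U \<Longrightarrow> (F has_derivative (\<lambda>h. K x *v h)) (at x)"
    and K: "\<And>p k. continuous_on U (\<lambda>x. K x $ p $ k)"
    and det: "\<And>x. x \<in> U \<Longrightarrow> det (completed S \<rho> (K x)) \<noteq> 0"
    and ker: "\<And>x v. x \<in> U \<Longrightarrow> (\<And>k. k \<in> S \<Longrightarrow> (K x *v v) $ \<rho> k = 0) \<Longrightarrow> K x *v v = 0"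
    and e: "e \<notin> S" and "0 < \<epsilon>"
  obtains x where "norm (x - x0) < \<epsilon>" "x \<in> U" "F x = F x0" "x $ e \<noteq> x0 $ e"
proof -
  define \<Phi> where "\<Phi> = partial_chart S \<rho> F"
  obtain U' V \<Psi> \<Psi>' where UV: "open U'" "U' \<subseteq> U" "x0 \<in> U'" "open V" "homeomorphism U' V \<Phi> \<Psi>"
    and \<Psi>: "\<And>y. y \<in> V \<Longrightarrow> (\<Psi> has_derivative \<Psi>' y) (at y)"
    and null: "\<And>y w. y \<in> V \<Longrightarrow> (\<And>k. k \<in> S \<Longrightarrow> w $ k = 0) \<Longrightarrow> K (\<Psi> y) *v \<Psi>' y w = 0"
    using constant_rank_chart[OF U F K det ker] unfolding \<Phi>_def by blast
  have inv: "\<Psi> (\<Phi> x) = x" "\<Phi> x \<in> V" if "x \<in> U'" for x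
    using UV(5) that by (auto simp: homeomorphism_def)
  have inv': "\<Phi> (\<Psi> y) = y" "\<Psi> y \<in> U'" if "y \<in> V" for y
    using UV(5) that by (auto simp: homeomorphism_def)
  have "open (V \<inter> \<Psi> -` ball x0 \<epsilon>)"
    using UV(4,5) by (intro continuous_open_preimage) (auto simp: homeomorphism_def)
  moreover have "\<Phi> x0 \<in> V \<inter> \<Psi> -` ball x0 \<epsilon>" using inv[OF UV(3)] \<open>0 < \<epsilon>\<close> by simp
  ultimately obtain r where r: "0 < r" "ball (\<Phi> x0) r \<subseteq> V \<inter> \<Psi> -` ball x0 \<epsilon>"
    using open_contains_ball by blast
  \<comment> \<open>A nonzero step of half the radius, so that the whole segment stays inside the
    open ball.\<close>
  define w :: "complex^'e" where "w = axis e (of_real (r / 2))"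
  have w: "w $ k = 0" if "k \<in> S" for k using that e by (auto simp: w_def axis_def)
  have "norm w = norm (complex_of_real (r / 2))"
    unfolding w_def norm_eq_sqrt_inner by (simp only: inner_axis_axis simp_thms if_True)
  then have "norm w < r" using r(1) by simp
  have ball: "\<Phi> x0 + t *\<^sub>R w \<in> ball (\<Phi> x0) r" if "t \<in> {0..1}" for t
  proof -
    have "norm (t *\<^sub>R w) \<le> 1 * norm w" using that by (simp add: mult_left_le_one_le)
    then show ?thesis using \<open>norm w < r\<close> by (simp add: dist_norm)
  qed
  then have V: "\<Phi> x0 + t *\<^sub>R w \<in> V" if "t \<in> {0..1}" for t using r(2) that by blast
  define h where "h = (\<lambda>t::real. F (\<Psi> (\<Phi> x0 + t *\<^sub>R w)))"
  have "(h has_derivative (\<lambda>_. 0)) (at t within {0..1})" if t: "t \<in> {0..1}" for t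
  proof -
    let ?y = "\<Phi> x0 + t *\<^sub>R w"
    have U: "\<Psi> ?y \<in> U" using inv'(2)[OF V[OF t]] UV(2) by blast
    have "((\<lambda>t. \<Psi> (\<Phi> x0 + t *\<^sub>R w)) has_derivative (\<lambda>s. \<Psi>' ?y (s *\<^sub>R w))) (at t within {0..1})"
      by (rule has_derivative_compose[of "\<lambda>t. \<Phi> x0 + t *\<^sub>R w" "\<lambda>s. s *\<^sub>R w", OF _ \<Psi>[OF V[OF t]]])
         (auto intro!: derivative_eq_intros)
    from has_derivative_compose[of "\<lambda>t. \<Psi> (\<Phi> x0 + t *\<^sub>R w)", OF this F[OF U]]
    have "(h has_derivative (\<lambda>s. K (\<Psi> ?y) *v \<Psi>' ?y (s *\<^sub>R w))) (at t within {0..1})" by (simp add: h_def)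
    moreover have "K (\<Psi> ?y) *v \<Psi>' ?y (s *\<^sub>R w) = 0" for s
      using w by (intro null[OF V[OF t]]) simp
    ultimately show ?thesis by simp
  qed
  then have "h 1 = h 0" using has_derivative_zero_unique[of "{0..1}" h] by auto
  define x where "x = \<Psi> (\<Phi> x0 + w)"
  have one: "\<Phi> x0 + w \<in> V \<inter> \<Psi> -` ball x0 \<epsilon>" using ball[of 1] r(2) by auto
  show thesis
  proof
    show "norm (x - x0) < \<epsilon>" using one by (simp add: x_def dist_norm norm_minus_commute)
    show "x \<in> U" using inv'(2) one UV(2) by (auto simp: x_def)
    show "F x = F x0" using \<open>h 1 = h 0\<close> inv(1)[OF UV(3)] by (simp add: h_def x_def)
    have "\<Phi> x = \<Phi> x0 + w" using inv'(1) one by (simp add: x_def)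
    then have "\<Phi> x $ e = \<Phi> x0 $ e + w $ e" by simp
    then show "x $ e \<noteq> x0 $ e" using e r(1) by (simp add: \<Phi>_def partial_chart_def w_def)
  qed
qed

section \<open>Genericity\<close>

text \<open>Otherwise two Lebesgue null sets would cover the admissible parameters, which form an
  open set containing 0.\<close>

lemma not_almost_all_and_almost_no:
  assumes "almost_all edge P" "almost_no edge P"
  shows False
proof -
  let ?U = "{x. det (mat 1 - param edge x) \<noteq> 0}"
  obtain Z1 Z2 where Z: "lower_dimensional Z1" "lower_dimensional Z2" "?U \<subseteq> Z1 \<union> Z2"
    using assms unfolding almost_all_def almost_no_def by blast
  then have "negligible ?U"
    by (meson lower_dimensional_imp_negligible negligible_Un negligible_subset)
  moreover have "0 \<in> ?U" by simp
  ultimately show False using open_det_param open_not_negligible by blast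
qed

lemma almost_no_mono:
  assumes "almost_no edge P" "\<And>x. det (mat 1 - param edge x) \<noteq> 0 \<Longrightarrow> Q x \<Longrightarrow> P x"
  shows "almost_no edge Q"
  using assms unfolding almost_no_def by meson

section \<open>Local identifiability in parameter space\<close>

lemma norm_param_le: "\<exists>c>0. \<forall>x. norm (param edge x) \<le> c * norm x"
proof -
  have "linear (param edge)"
    by (rule linearI) (auto simp: param_def vec_eq_iff scaleR_sum_right simp flip: sum.distrib intro!: sum.cong)
  then show ?thesis using linear_conv_bounded_linear bounded_linear.pos_bounded by (metis mult.commute)
qed

lemma norm_le_param:
  assumes "inj edge"
  shows "norm x \<le> CARD('e) * norm (param edge (x :: complex^'e))"
proof -
  have "norm (x $ k) \<le> norm (param edge x)" for k
  proof -
    obtain j i where k: "edge k = (j, i)" by fastforce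
    have "norm (x $ k) \<le> norm (param edge x $ i)"
      unfolding param_nth[OF assms k, symmetric] by (rule Finite_Cartesian_Product.norm_nth_le)
    also have "\<dots> \<le> norm (param edge x)" by (rule Finite_Cartesian_Product.norm_nth_le)
    finally show ?thesis .
  qed
  then have "(\<Sum>k\<in>UNIV. norm (x $ k)) \<le> (\<Sum>k\<in>(UNIV::'e set). norm (param edge x))"
    by (intro sum_mono)
  moreover have "norm x \<le> (\<Sum>k\<in>UNIV. norm (x $ k))"
    unfolding norm_vec_def by (rule L2_set_le_sum) simp
  ultimately show ?thesis by simp
qed

text \<open>The norms of \<open>x\<close> and of \<open>param edge x\<close> are equivalent, so
  small neighbourhoods correspond; only the radius changes.\<close>

lemma locally_identifiable_iff:
  fixes edge :: "'e::finite \<Rightarrow> 'n::finite \<times> 'n"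
  assumes edge: "bij_betw edge UNIV E" and e: "edge e = (j, i)"
  shows "locally_identifiable E B C i j (param edge x) \<longleftrightarrow>
    (\<exists>\<epsilon>>0. \<forall>y. det (mat 1 - param edge y) \<noteq> 0 \<longrightarrow> norm (y - x) < \<epsilon> \<longrightarrow>
       transfer_vector edge B C y = transfer_vector edge B C x \<longrightarrow> y $ e = x $ e)"
    (is "_ \<longleftrightarrow> ?R")
proof -
  have inj: "inj edge" using edge by (rule bij_betw_imp_inj_on)
  let ?T = "\<lambda>G. C ** matrix_inv (mat 1 - G) ** B"
  have T: "transfer_vector edge B C y = transfer_vector edge B C x \<longleftrightarrow> ?T (param edge y) = ?T (param edge x)" for y
    by (simp add: transfer_vector_def vectorize_eq_iff transfer_matrix_def)
  have net: "network_matrix E (param edge y) \<longleftrightarrow> det (mat 1 - param edge y) \<noteq> 0" for y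
    by (simp add: network_matrix_def consistent_param[OF edge] invertible_det_nz)
  show ?thesis
  proof
    assume "locally_identifiable E B C i j (param edge x)"
    then obtain \<epsilon> where \<epsilon>: "\<epsilon> > 0" "\<And>G'. network_matrix E G' \<Longrightarrow> norm (G' - param edge x) < \<epsilon> \<Longrightarrow>
        ?T G' = ?T (param edge x) \<Longrightarrow> G' $ i $ j = param edge x $ i $ j"
      unfolding locally_identifiable_def by blast
    obtain c where c: "c > 0" "\<And>y. norm (param edge y) \<le> c * norm y" using norm_param_le[of edge] by blast
    show ?R
    proof (intro exI conjI allI impI)
      show "0 < \<epsilon> / c" using \<epsilon>(1) c(1) by simp
      fix y assume y: "det (mat 1 - param edge y) \<noteq> 0" "norm (y - x) < \<epsilon> / c"
        "transfer_vector edge B C y = transfer_vector edge B C x"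
      have "norm (param edge y - param edge x) \<le> c * norm (y - x)" using c(2)[of "y - x"] by (simp add: param_diff)
      also have "\<dots> < \<epsilon>" using y(2) c(1) by (simp add: field_simps)
      finally have "param edge y $ i $ j = param edge x $ i $ j" using \<epsilon>(2)[of "param edge y"] y net T by blast
      then show "y $ e = x $ e" by (simp add: param_nth[OF inj e])
    qed
  next
    assume ?R
    then obtain \<epsilon> where \<epsilon>: "\<epsilon> > 0" "\<And>y. det (mat 1 - param edge y) \<noteq> 0 \<Longrightarrow> norm (y - x) < \<epsilon> \<Longrightarrow>
       transfer_vector edge B C y = transfer_vector edge B C x \<Longrightarrow> y $ e = x $ e" by blast
    show "locally_identifiable E B C i j (param edge x)"
      unfolding locally_identifiable_def
    proof (intro exI conjI allI impI)
      show "0 < \<epsilon> / CARD('e)" using \<epsilon>(1) by simp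
      fix G' assume G': "network_matrix E G'" "norm (G' - param edge x) < \<epsilon> / CARD('e)" "?T G' = ?T (param edge x)"
      obtain y where y: "G' = param edge y"
        using consistent_imp_param[OF edge] G'(1) unfolding network_matrix_def by blast
      have "norm (y - x) \<le> CARD('e) * norm (param edge (y - x))" by (rule norm_le_param[OF inj])
      also have "\<dots> < \<epsilon>" using G'(2) by (simp add: y param_diff field_simps)
      finally have "y $ e = x $ e" using \<epsilon>(2)[of y] G' net T y by blast
      then show "G' $ i $ j = param edge x $ i $ j" by (simp add: y param_nth[OF inj e])
    qed
  qed
qed

text \<open>One exceptional set, the zeros of a maximal minor, serves both the kernel condition and
  local identifiability. Whether \<open>e\<close> belongs to the columns \<open>S\<close> of this
  minor decides between the alternatives.\<close>

theorem generic_local_identifiability_dichotomy: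
  fixes E :: "('n::finite \<times> 'n) set" and edge :: "'e::finite \<Rightarrow> 'n \<times> 'n"
    and B :: "complex^'b::finite^'n" and C :: "complex^'n^'c::finite"
  assumes edge: "bij_betw edge UNIV E" and e: "edge e = (j, i)"
  shows "(almost_all edge (\<lambda>x. ker_perp (K_matrix edge B C x) e) \<and>
       generically_locally_identifiable E edge B C i j) \<or>
    (almost_no edge (\<lambda>x. ker_perp (K_matrix edge B C x) e) \<and>
       generically_locally_nonidentifiable E edge B C i j)"
proof -
  let ?U = "{x. det (mat 1 - param edge x) \<noteq> 0}" and ?K = "K_matrix edge B C"
  let ?F = "transfer_vector edge B C"
  have "0 \<in> ?U" by simp
  from generic_kernel[OF this, of ?K e] obtain S \<rho> x0 where x0: "x0 \<in> ?U" "det (completed S \<rho> (?K x0)) \<noteq> 0"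
    and ker: "\<forall>x\<in>?U. det (completed S \<rho> (?K x)) \<noteq> 0 \<longrightarrow>
      (\<forall>v. (\<forall>k\<in>S. (?K x *v v) $ \<rho> k = 0) \<longrightarrow> ?K x *v v = 0)"
    and e_S: "e \<notin> S \<or> (\<forall>x\<in>?U. det (completed S \<rho> (?K x)) \<noteq> 0 \<longrightarrow> ker_perp (?K x) e)"
    by (elim exE conjE bexE)
  \<comment> \<open>The polynomial form of the chosen minor; on admissible parameters it has the
    same zeros.\<close>
  define p where "p = (\<lambda>x. det (completed S \<rho> (polynomial_K edge B C x)))"
  have p: "complex_polynomial p"
    unfolding p_def
  proof (rule complex_polynomial_det)
    fix k l show "complex_polynomial (\<lambda>x. completed S \<rho> (polynomial_K edge B C x) $ k $ l)"
      by (cases "k \<in> S")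
         (auto simp: completed_def intro: complex_polynomial_const complex_polynomial_polynomial_K)
  qed
  have p_iff: "det (completed S \<rho> (?K x)) \<noteq> 0 \<longleftrightarrow> p x \<noteq> 0" if "x \<in> ?U" for x
    using det_completed_K_iff that unfolding p_def by blast
  define Z where "Z = {x. p x = 0}"
  have Z: "lower_dimensional Z"
    unfolding Z_def using p x0 p_iff by (intro lower_dimensional_complex_polynomial_zeros[of _ x0]) auto
  define W where "W = {x \<in> ?U. p x \<noteq> 0}"
  have "W = ?U \<inter> {x. p x \<noteq> 0}" by (auto simp: W_def)
  moreover have "open {x. p x \<noteq> 0}"
    using complex_polynomial_continuous[OF p, of UNIV] by (intro open_Collect_neq) auto
  ultimately have W: "open W" using open_det_param by auto
  have F: "(?F has_derivative (\<lambda>h. ?K x *v h)) (at x)" if "x \<in> W" for x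
    using that transfer_vector_has_derivative by (auto simp: W_def)
  have K: "continuous_on W (\<lambda>x. ?K x $ q $ k)" for q k
    using continuous_on_K_entry by (rule continuous_on_subset) (auto simp: W_def)
  have det: "det (completed S \<rho> (?K x)) \<noteq> 0" if "x \<in> W" for x using that p_iff by (auto simp: W_def)
  have kerW: "?K x *v v = 0" if "x \<in> W" "\<And>k. k \<in> S \<Longrightarrow> (?K x *v v) $ \<rho> k = 0" for x v
    using ker that det[OF that(1)] unfolding W_def by blast
  have WI: "x \<in> W" if "det (mat 1 - param edge x) \<noteq> 0" "x \<notin> Z" for x
    using that by (auto simp: W_def Z_def)
  show ?thesis
  proof (cases "e \<in> S")
    case True
    then have perp: "ker_perp (?K x) e" if "x \<in> W" for x
      using e_S det[OF that] that by (auto simp: W_def)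
    have "locally_identifiable E B C i j (param edge x)" if x: "x \<in> W" for x
    proof -
      obtain \<epsilon> where "0 < \<epsilon>" "\<And>y. norm (y - x) < \<epsilon> \<Longrightarrow> ?F y = ?F x \<Longrightarrow> y $ e = x $ e"
        using constant_rank_fibre_constant[OF W x F K det kerW perp] by blast
      then show ?thesis unfolding locally_identifiable_iff[OF edge e] by blast
    qed
    then show ?thesis
      using perp Z WI unfolding almost_all_def generically_locally_identifiable_def by blast
  next
    case False
    have "\<not> ker_perp (?K x) e" if x: "x \<in> W" for x
    proof
      assume perp: "ker_perp (?K x) e"
      obtain A' where A': "completed S \<rho> (?K x) ** A' = mat 1"
        using det[OF x] by (metis invertible_det_nz invertible_right_inverse)
      \<comment> \<open>The preimage of the unit vector at \<open>e\<close>: as \<open>e\<close> is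
        outside \<open>S\<close>, the selected rows kill \<open>v\<close>, while its entry at
        \<open>e\<close> is 1.\<close>
      define v where "v = A' *v axis e 1"
      have v: "completed S \<rho> (?K x) *v v = axis e 1" by (simp add: v_def matrix_vector_mul_assoc A')
      have "(?K x *v v) $ \<rho> k = 0" if "k \<in> S" for k
        using arg_cong[OF v, of "\<lambda>u. u $ k"] that False by (auto simp: completed_mult_vec axis_def split: if_splits)
      then have "?K x *v v = 0" by (rule kerW[OF x])
      moreover have "v $ e = 1"
        using arg_cong[OF v, of "\<lambda>u. u $ e"] False by (simp add: completed_mult_vec axis_def)
      ultimately show False using perp by (simp add: ker_perp_def)
    qed
    moreover have "\<not> locally_identifiable E B C i j (param edge x)" if x: "x \<in> W" for x
      unfolding locally_identifiable_iff[OF edge e]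
    proof (intro notI, elim exE conjE)
      fix \<epsilon> :: real assume \<epsilon>: "0 < \<epsilon>" "\<forall>y. det (mat 1 - param edge y) \<noteq> 0 \<longrightarrow> norm (y - x) < \<epsilon> \<longrightarrow>
          ?F y = ?F x \<longrightarrow> y $ e = x $ e"
      obtain y where "norm (y - x) < \<epsilon>" "y \<in> W" "?F y = ?F x" "y $ e \<noteq> x $ e"
        using constant_rank_fibre_nonconstant[OF W x F K det kerW False \<epsilon>(1)] by blast
      then show False using \<epsilon>(2) by (auto simp: W_def)
    qed
    ultimately show ?thesis
      using Z WI unfolding almost_no_def generically_locally_nonidentifiable_def by blast
  qed
qed

theorem mainTheorem1:
  fixes E :: "('n::finite \<times> 'n) set"
    and \<B> \<C> :: "'n set"
    and edge :: "'e::finite \<Rightarrow> 'n \<times> 'n"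
    and exc :: "'b::finite \<Rightarrow> 'n"
    and meas :: "'c::finite \<Rightarrow> 'n"
    and B :: "complex^'b^'n"
    and C :: "complex^'n^'c"
    and i j :: 'n
    and e :: 'e
  assumes edge: "bij_betw edge UNIV E"
    and exc: "\<B> = {} \<or> bij_betw exc UNIV \<B>"
    and meas: "\<C> = {} \<or> bij_betw meas UNIV \<C>"
    and B: "B = excitation_matrix \<B> exc"
    and C: "C = measurement_matrix \<C> meas"
    and ij: "(j, i) \<in> E"
    and e: "edge e = (j, i)"
  shows "
    (almost_all edge (\<lambda>x. ker_perp (K_matrix edge B C x) e) \<and>
     generically_locally_identifiable E edge B C i j)
    \<noteq>
    (almost_no edge (\<lambda>x. ker_perp (K_matrix edge B C x) e) \<and>
     generically_locally_nonidentifiable E edge B C i j \<and>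
     generically_nonidentifiable E edge B C i j)
    \<and>
    (\<forall>x. det (mat 1 - param edge x) \<noteq> 0 \<longrightarrow>
       (ker_perp (K_matrix edge B C x) e \<longleftrightarrow>
        (\<forall>\<Delta>. consistent E \<Delta> \<longrightarrow>
           C ** matrix_inv (mat 1 - param edge x) ** \<Delta> ** matrix_inv (mat 1 - param edge x) ** B = 0
           \<longrightarrow> \<Delta> $ i $ j = 0)))"
proof -
  \<comment> \<open>Identifiability implies local identifiability with any radius, here 1; so the
    failure of the latter passes to the former.\<close>
  have "generically_nonidentifiable E edge B C i j"
    if "generically_locally_nonidentifiable E edge B C i j"
    using that unfolding generically_locally_nonidentifiable_def generically_nonidentifiable_def
    by (rule almost_no_mono) (auto simp: identifiable_def locally_identifiable_def intro!: exI[of _ 1])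
  \<comment> \<open>The kernel conditions alone exclude each other, which turns the disjunction of
    the dichotomy into the inequality of truth values.\<close>
  moreover have "\<not> (almost_all edge (\<lambda>x. ker_perp (K_matrix edge B C x) e) \<and>
      almost_no edge (\<lambda>x. ker_perp (K_matrix edge B C x) e))"
    using not_almost_all_and_almost_no by blast
  ultimately show ?thesis
    using generic_local_identifiability_dichotomy[OF assms(1) assms(7), of B C] ker_perp_K_iff[OF assms(1) assms(7)]
    by blast
qed

end
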